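(* Let $p,q\in L^2([0,1],\mathbb{R})$ and $\alpha\in\mathbb{R}$. The solutions $C(\lambda,x)$, $S(\lambda,x)$ and $\varphi_\alpha(\lambda,x)$ of the Dirac equation $BY'+Q(x)Y=\lambda Y$ with initial values $C(\lambda,0)=(1,0)^T$, $S(\lambda,0)=(0,1)^T$, $\varphi_\alpha(\lambda,0)=(\sin\alpha,-\cos\alpha)^T$ admit the following Neumann series of Bessel functions (NSBF) representations: $$C(\lambda,x)=\begin{pmatrix}\cos\lambda x\\ \sin\lambda x\end{pmatrix}+2\sum_{n=0}^\infty(-1)^nK_n^C(x)\begin{pmatrix}j_{2n}(\lambda x)\\ j_{2n+1}(\lambda x)\end{pmatrix},$$ $$S(\lambda,x)=\begin{pmatrix}-\sin\lambda x\\ \cos\lambda x\end{pmatrix}+2\sum_{n=0}^\infty(-1)^nK_n^S(x)\begin{pmatrix}-j_{2n+1}(\lambda x)\\ j_{2n}(\lambda x)\end{pmatrix},$$ $$\varphi_\alpha(\lambda,x)=\begin{pmatrix}\sin(\lambda x+\alpha)\\ -\cos(\lambda x+\alpha)\end{pmatrix}+2\sum_{n=0}^\infty(-1)^nK_n^\alpha(x)\begin{pmatrix}j_{2n+1}(\lambda x)\\ -j_{2n}(\lambda x)\end{pmatrix}.$$ For every $\lambda\in\mathbb{C}$ the series converge pointwise. For every $x\in[0,1]$ the series converge uniformly on any compact set of the complex plane of the variable $\lambda$, and the remainders of their partial sums admit estimates independent of $\operatorname{Re}\lambda$.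
   Context: Here $B=\begin{pmatrix}0&1\\ -1&0\end{pmatrix}$, $Q(x)=\begin{pmatrix}p(x)&q(x)\\ q(x)&-p(x)\end{pmatrix}$, $x\in[0,1]$, and $j_\nu$ is the spherical Bessel function of the first kind of order $\nu$. $P_n$ is the $n$-th Legendre polynomial and $\mathcal{M}_2$ is the space of $2\times2$ complex matrices. It is known that there is a matrix-valued kernel $K(x,t)$ with $K(x,\cdot)\in L^2([-x,x],\mathcal{M}_2)$ such that the matrix solution $U(\lambda,x)$ of $BU'+QU=\lambda U$, $U(\lambda,0)=I$, is $U(\lambda,x)=e^{-B\lambda x}+\int_{-x}^xK(x,t)e^{-B\lambda t}dt$ for all $\lambda\in\mathbb{C}$. For $x>0$ write its Fourier-Legendre expansion as $K(x,t)=\sum_{n=0}^\infty\frac1xK_n(x)P_n(t/x)$, convergent in $L^2((-x,x),\mathcal{M}_2)$, with $K_n(x)=\left(K_{ij}^{(n)}(x)\right)_{i,j=1}^2$ (i.e. $K_n(x)=\frac{2n+1}{2}\int_{-x}^xK(x,t)P_n(t/x)\,dt$); at $x=0$ put $K_n(0)=0$. Define $$K_n^C(x)=\begin{pmatrix}K_{11}^{(2n)}(x)&K_{12}^{(2n+1)}(x)\\ K_{21}^{(2n)}(x)&K_{22}^{(2n+1)}(x)\end{pmatrix},\qquad K_n^S(x)=\begin{pmatrix}K_{11}^{(2n+1)}(x)&K_{12}^{(2n)}(x)\\ K_{21}^{(2n+1)}(x)&K_{22}^{(2n)}(x)\end{pmatrix},$$ $$K_n^\alpha(x)=\begin{pmatrix}\cos\alpha\,K_{11}^{(2n+1)}(x)+\sin\alpha\,K_{12}^{(2n+1)}(x)&-\sin\alpha\,K_{11}^{(2n)}(x)+\cos\alpha\,K_{12}^{(2n)}(x)\\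 \cos\alpha\,K_{21}^{(2n+1)}(x)+\sin\alpha\,K_{22}^{(2n+1)}(x)&-\sin\alpha\,K_{21}^{(2n)}(x)+\cos\alpha\,K_{22}^{(2n)}(x)\end{pmatrix}.$$ *)

theory Defs
  imports "HOL-Analysis.Analysis" "HOL-Computational_Algebra.Polynomial"
begin

section \<open>Function classes\<close>

definition square_integrable_on :: "(real \<Rightarrow> 'a::real_normed_vector) \<Rightarrow> real set \<Rightarrow> bool"
    (infixl \<open>square'_integrable'_on\<close> 46) where
  "f square_integrable_on S \<longleftrightarrow>
     f \<in> borel_measurable (lebesgue_on S) \<and> integrable (lebesgue_on S) (\<lambda>t. (norm (f t))\<^sup>2)"

text \<open>
  The usual epsilon-delta condition. A set \<open>D\<close> with \<open>D division_of \<Union>D\<close> is a finite family of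
  nonoverlapping compact intervals \<open>k = {Inf k..Sup k}\<close>.
\<close>
definition absolutely_continuous_on :: "real set \<Rightarrow> (real \<Rightarrow> 'a::real_normed_vector) \<Rightarrow> bool" where
  "absolutely_continuous_on S f \<longleftrightarrow>
     (\<forall>\<epsilon>>0. \<exists>\<delta>>0. \<forall>D. D division_of \<Union>D \<and> \<Union>D \<subseteq> S \<and> (\<Sum>k\<in>D. Sup k - Inf k) < \<delta> \<longrightarrow>
        (\<Sum>k\<in>D. norm (f (Sup k) - f (Inf k))) < \<epsilon>)"


section \<open>The Dirac equation\<close>

definition dirac_B :: "complex^2^2" where
  "dirac_B = vector [vector [0, 1], vector [-1, 0]]"

definition dirac_Q :: "(real \<Rightarrow> real) \<Rightarrow> (real \<Rightarrow> real) \<Rightarrow> real \<Rightarrow> complex^2^2" where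
  "dirac_Q p q x = vector [vector [of_real (p x), of_real (q x)],
                           vector [of_real (q x), - of_real (p x)]]"

text \<open>
  The coefficients are only square integrable, so a solution on \<open>[0,1]\<close> is understood in the sense
  of Caratheodory: an absolutely continuous function satisfying the equation almost everywhere.
\<close>
definition dirac_solution ::
    "(real \<Rightarrow> real) \<Rightarrow> (real \<Rightarrow> real) \<Rightarrow> complex \<Rightarrow> (real \<Rightarrow> complex^2) \<Rightarrow> bool" where
  "dirac_solution p q z Y \<longleftrightarrow> absolutely_continuous_on {0..1} Y \<and>
     (AE x in lebesgue_on {0..1}. \<exists>Y'. (Y has_vector_derivative Y') (at x within {0..1}) \<and>
        dirac_B *v Y' + dirac_Q p q x *v Y x = z *s Y x)"

definition dirac_matrix_solution ::
    "(real \<Rightarrow> real) \<Rightarrow> (real \<Rightarrow> real) \<Rightarrow> complex \<Rightarrow> (real \<Rightarrow> complex^2^2) \<Rightarrow> bool" where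
  "dirac_matrix_solution p q z U \<longleftrightarrow> absolutely_continuous_on {0..1} U \<and>
     (AE x in lebesgue_on {0..1}. \<exists>U'. (U has_vector_derivative U') (at x within {0..1}) \<and>
        dirac_B ** U' + dirac_Q p q x ** U x = mat z ** U x)"

definition matrix_exp :: "complex^2^2 \<Rightarrow> complex^2^2" where
  "matrix_exp A = (\<Sum>k. (1 / fact k) *\<^sub>R (((**) A ^^ k) (mat 1)))"


section \<open>Special functions\<close>

text \<open>Rodrigues' formula.\<close>
definition legendre_poly :: "nat \<Rightarrow> real poly" where
  "legendre_poly n = smult (1 / (2 ^ n * fact n)) ((pderiv ^^ n) ([:-1, 0, 1:] ^ n))"

definition bessel_J :: "complex \<Rightarrow> complex \<Rightarrow> complex" where
  "bessel_J \<nu> z =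
     (z / 2) powr \<nu> * (\<Sum>k. (-1) ^ k * rGamma (\<nu> + of_nat k + 1) / fact k * (z / 2) ^ (2 * k))"

text \<open>
  The spherical Bessel function \<open>j\<^sub>n(z) = sqrt(\<pi> / (2 z)) J\<^bsub>n+1/2\<^esub>(z)\<close> is entire. With principal
  branches that formula is meaningless at \<open>0\<close> and has the wrong sign on the negative half-line, so
  the fractional powers are cancelled in the definition.
\<close>
definition spherical_bessel_j :: "nat \<Rightarrow> complex \<Rightarrow> complex" where
  "spherical_bessel_j n z =
     of_real (sqrt pi / 2) * (z / 2) ^ n *
       (\<Sum>k. (-1) ^ k * rGamma (of_nat n + 1 / 2 + of_nat k + 1) / fact k * (z / 2) ^ (2 * k))"

lemma spherical_bessel_j_eq_bessel_J:
  assumes "z \<notin> \<real>\<^sub>\<le>\<^sub>0"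
  shows "spherical_bessel_j n z = csqrt (of_real pi / (2 * z)) * bessel_J (of_nat n + 1 / 2) z"
proof -
  have z: "z \<noteq> 0" using assms by auto
  have Lz: "Ln (z / 2) = Ln z - of_real (ln 2)"
    using z Ln_divide_of_real[of 2 z] by simp
  have Lpi: "Ln (of_real pi / (2 * z)) = of_real (ln pi) - of_real (ln 2) - Ln z"
  proof -
    have i: "Ln (inverse z) = - Ln z" using Ln_inverse[OF assms] .
    have "of_real pi / (2 * z) = of_real (pi / 2) * inverse z" by (simp add: field_simps)
    then have "Ln (of_real pi / (2 * z)) = of_real (ln (pi / 2)) + Ln (inverse z)"
      using z Ln_times_of_real[of "pi / 2" "inverse z"] by (simp only:) (simp add: Ln_of_real[of "pi / 2"] del: of_real_divide)
    also have "ln (pi / 2) = ln pi - ln 2" by (simp add: ln_div)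
    finally show ?thesis using i by simp
  qed
  have "csqrt (of_real pi / (2 * z)) * (z / 2) powr (of_nat n + 1 / 2)
      = exp (Ln (of_real pi / (2 * z)) / 2) * (exp (Ln (z / 2) / 2) * (z / 2) powr of_nat n)"
    using z by (simp add: csqrt_exp_Ln powr_add) (simp add: powr_def)
  also have "\<dots> = exp (of_real (ln pi) / 2 - of_real (ln 2)) * (z / 2) powr of_nat n"
  proof -
    have "Ln (of_real pi / (2 * z)) / 2 + Ln (z / 2) / 2 = of_real (ln pi) / 2 - of_real (ln 2)"
      unfolding Lz Lpi by (simp add: field_simps)
    then show ?thesis by (metis exp_add mult.assoc)
  qed
  also have "exp (of_real (ln pi) / 2 - of_real (ln 2)) = complex_of_real (exp (ln pi / 2 - ln 2))"
    by (simp flip: exp_of_real)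
  also have "exp (ln pi / 2 - ln 2) = sqrt pi / 2"
    by (simp add: exp_diff powr_half_sqrt[symmetric] powr_def)
  also have "(z / 2) powr of_nat n = (z / 2) ^ n" using z by (simp add: powr_nat')
  finally show ?thesis by (simp add: spherical_bessel_j_def bessel_J_def mult.assoc[symmetric])
qed


section \<open>Fourier--Legendre coefficients of the kernel\<close>

definition FL_coeff :: "(real \<Rightarrow> real \<Rightarrow> complex^2^2) \<Rightarrow> nat \<Rightarrow> real \<Rightarrow> complex^2^2" where
  "FL_coeff K n x = (if x = 0 then 0 else
     ((2 * real n + 1) / 2) *\<^sub>R
       (LINT t|lebesgue_on {-x..x}. poly (legendre_poly n) (t / x) *\<^sub>R K x t))"

definition FL_coeff_C :: "(real \<Rightarrow> real \<Rightarrow> complex^2^2) \<Rightarrow> nat \<Rightarrow> real \<Rightarrow> complex^2^2" where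
  "FL_coeff_C K n x =
     vector [vector [FL_coeff K (2*n) x $ 1 $ 1, FL_coeff K (2*n+1) x $ 1 $ 2],
             vector [FL_coeff K (2*n) x $ 2 $ 1, FL_coeff K (2*n+1) x $ 2 $ 2]]"

definition FL_coeff_S :: "(real \<Rightarrow> real \<Rightarrow> complex^2^2) \<Rightarrow> nat \<Rightarrow> real \<Rightarrow> complex^2^2" where
  "FL_coeff_S K n x =
     vector [vector [FL_coeff K (2*n+1) x $ 1 $ 1, FL_coeff K (2*n) x $ 1 $ 2],
             vector [FL_coeff K (2*n+1) x $ 2 $ 1, FL_coeff K (2*n) x $ 2 $ 2]]"

definition FL_coeff_\<alpha> :: "real \<Rightarrow> (real \<Rightarrow> real \<Rightarrow> complex^2^2) \<Rightarrow> nat \<Rightarrow> real \<Rightarrow> complex^2^2" where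
  "FL_coeff_\<alpha> \<alpha> K n x = (let c = of_real (cos \<alpha>); s = of_real (sin \<alpha>) in
     vector [vector [c * FL_coeff K (2*n+1) x $ 1 $ 1 + s * FL_coeff K (2*n+1) x $ 1 $ 2,
                     - s * FL_coeff K (2*n) x $ 1 $ 1 + c * FL_coeff K (2*n) x $ 1 $ 2],
             vector [c * FL_coeff K (2*n+1) x $ 2 $ 1 + s * FL_coeff K (2*n+1) x $ 2 $ 2,
                     - s * FL_coeff K (2*n) x $ 2 $ 1 + c * FL_coeff K (2*n) x $ 2 $ 2]])"


section \<open>Neumann series of Bessel functions\<close>

definition nsbf_init_C :: "complex \<Rightarrow> real \<Rightarrow> complex^2" where
  "nsbf_init_C z x = vector [cos (z * of_real x), sin (z * of_real x)]"

definition nsbf_init_S :: "complex \<Rightarrow> real \<Rightarrow> complex^2" where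
  "nsbf_init_S z x = vector [- sin (z * of_real x), cos (z * of_real x)]"

definition nsbf_init_\<alpha> :: "real \<Rightarrow> complex \<Rightarrow> real \<Rightarrow> complex^2" where
  "nsbf_init_\<alpha> \<alpha> z x =
     vector [sin (z * of_real x + of_real \<alpha>), - cos (z * of_real x + of_real \<alpha>)]"

definition nsbf_term_C :: "(real \<Rightarrow> real \<Rightarrow> complex^2^2) \<Rightarrow> complex \<Rightarrow> real \<Rightarrow> nat \<Rightarrow> complex^2" where
  "nsbf_term_C K z x n = ((-1) ^ n) *s (FL_coeff_C K n x *v
     vector [spherical_bessel_j (2 * n) (z * of_real x),
             spherical_bessel_j (2 * n + 1) (z * of_real x)])"

definition nsbf_term_S :: "(real \<Rightarrow> real \<Rightarrow> complex^2^2) \<Rightarrow> complex \<Rightarrow> real \<Rightarrow> nat \<Rightarrow> complex^2" where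
  "nsbf_term_S K z x n = ((-1) ^ n) *s (FL_coeff_S K n x *v
     vector [- spherical_bessel_j (2 * n + 1) (z * of_real x),
             spherical_bessel_j (2 * n) (z * of_real x)])"

definition nsbf_term_\<alpha> ::
    "real \<Rightarrow> (real \<Rightarrow> real \<Rightarrow> complex^2^2) \<Rightarrow> complex \<Rightarrow> real \<Rightarrow> nat \<Rightarrow> complex^2" where
  "nsbf_term_\<alpha> \<alpha> K z x n = ((-1) ^ n) *s (FL_coeff_\<alpha> \<alpha> K n x *v
     vector [spherical_bessel_j (2 * n + 1) (z * of_real x),
             - spherical_bessel_j (2 * n) (z * of_real x)])"

text \<open>
  The estimate of the \<open>N\<close>-th remainder is a null sequence times a factor that depends on \<open>z\<close> only
  through \<open>|Im z|\<close>, and monotonically; so the remainders tend to zero uniformly on every horizontal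
  strip.
\<close>
definition Re_independent_remainder_estimate ::
    "(complex \<Rightarrow> complex^2) \<Rightarrow> (nat \<Rightarrow> complex \<Rightarrow> complex^2) \<Rightarrow> bool" where
  "Re_independent_remainder_estimate Y Y\<^sub>N \<longleftrightarrow>
     (\<exists>(\<epsilon> :: nat \<Rightarrow> real) (c :: real \<Rightarrow> real). \<epsilon> \<longlonglongrightarrow> 0 \<and> mono c \<and>
        (\<forall>N z. norm (Y z - Y\<^sub>N N z) \<le> \<epsilon> N * c \<bar>Im z\<bar>))"

end

theory Submission
  imports Defs
begin

text \<open>
  The solutions \<open>C\<close> and \<open>S\<close> are the two columns of the matrix solution \<open>U\<close>, and \<open>\<phi>\<^sub>\<alpha>\<close> is a linear combination of
  them, because absolutely continuous solutions of the Dirac equation are determined by their initial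
  values (\<open>dirac_solution_unique\<close>). As \<open>matrix_exp (- t z B)\<close> is the rotation with entries \<open>cos (z t)\<close> and
  \<open>\<plusminus> sin (z t)\<close> (\<open>matrix_exp_dirac_B\<close>), the integral representation of \<open>U\<close> expresses every component of a
  solution through integrals of an entry \<open>f\<close> of the kernel against \<open>cos (z t)\<close> and \<open>sin (z t)\<close> over \<open>{-x..x}\<close>.

  For a fixed \<open>x > 0\<close> such an integral is a bilinear pairing of square integrable functions, which can be
  evaluated by Parseval's formula for the orthogonal basis \<open>P\<^sub>n (t / x)\<close>. Up to constants, the coefficients of \<open>f\<close> are the entries of
  \<open>FL_coeff\<close>, and those of \<open>cos (z t)\<close> and \<open>sin (z t)\<close> are spherical Bessel functions of even and of odd order,
  since the integral of \<open>P\<^sub>n (t / x) exp (\<i> z t)\<close> is \<open>2 x \<i>\<^sup>n j\<^sub>n (z x)\<close> (\<open>legendre_exp_integral\<close>). So Parseval's series is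
  the Neumann series of Bessel functions.

  The remainder after \<open>N\<close> terms is the integral of \<open>f - f\<^sub>N\<close> against \<open>cos (z t)\<close> or \<open>sin (z t)\<close>, where \<open>f\<^sub>N\<close> is the
  partial sum of the Legendre series of \<open>f\<close>. By the Cauchy-Schwarz inequality it is at most the mean square
  error of \<open>f\<^sub>N\<close>, which does not involve \<open>z\<close> and tends to \<open>0\<close> (\<open>legendre_sum_tendsto\<close>, from the density of
  polynomials), times a multiple of \<open>exp (x \<bar>Im z\<bar>)\<close>. This single estimate (\<open>bessel_series_remainder\<close>) gives
  convergence at each point, uniform convergence on compact sets and the independence of \<open>Re z\<close>.
\<close>

section \<open>Absolutely continuous functions and uniqueness\<close>

text \<open>
  The gauge integral makes the exceptional null set \<open>N\<close> harmless. Change the integrand to \<open>0\<close> on \<open>N\<close>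
  and compare \<open>f b - f a\<close> with a Riemann sum, one tagged interval at a time. If the tag is outside \<open>N\<close>,
  differentiability at the tag controls the error as in the classical proof. The intervals with tag
  in \<open>N\<close> are forced by the gauge into an open set of small measure, and absolute continuity
  says that \<open>f\<close> changes little over them.
\<close>
lemma absolutely_continuous_FTC:
  fixes f :: "real \<Rightarrow> 'a::banach"
  assumes ac: "absolutely_continuous_on {a..b} f" and ab: "a \<le> b" and N: "negligible N"
    and der: "\<And>x. x \<in> {a..b} - N \<Longrightarrow> (f has_vector_derivative f' x) (at x within {a..b})"
  shows "(f' has_integral (f b - f a)) {a..b}"
proof -
  define g where "g x = (if x \<in> N then 0 else f' x)" for x
  have "(g has_integral (f b - f a)) (cbox a b)"
    unfolding has_integral
  proof (intro allI impI)
    fix e :: real assume e: "e > 0"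
    \<comment> \<open>The \<open>+ 1\<close> covers the case of a degenerate interval.\<close>
    define e1 where "e1 = e / (2 * (b - a + 1))"
    have e1: "e1 > 0" using e ab by (simp add: e1_def)
    have "\<exists>d>0. x \<in> {a..b} - N \<longrightarrow>
         (\<forall>y\<in>{a..b}. norm (y-x) < d \<longrightarrow> norm (f y - f x - (y-x) *\<^sub>R f' x) \<le> e1 * norm (y-x))" for x
      using der[of x, unfolded has_vector_derivative_def has_derivative_within_alt] e1
      by (cases "x \<in> {a..b} - N") (blast, auto intro: zero_less_one)
    then obtain d where d: "\<And>x. 0 < d x"
         "\<And>x y. \<lbrakk>x \<in> {a..b} - N; y \<in> {a..b}; norm (y-x) < d x\<rbrakk>
                        \<Longrightarrow> norm (f y - f x - (y-x) *\<^sub>R f' x) \<le> e1 * norm (y-x)"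
      by metis
    obtain \<delta> where \<delta>: "\<delta> > 0" "\<And>D. \<lbrakk>D division_of \<Union>D; \<Union>D \<subseteq> {a..b}; (\<Sum>k\<in>D. Sup k - Inf k) < \<delta>\<rbrakk>
        \<Longrightarrow> (\<Sum>k\<in>D. norm (f (Sup k) - f (Inf k))) < e / 2"
      using ac e unfolding absolutely_continuous_on_def by (meson half_gt_zero)
    have Nn: "N \<in> null_sets lebesgue" using N by (simp add: negligible_iff_null_sets)
    then obtain T where T: "open T" "N \<subseteq> T" "T - N \<in> lmeasurable" "emeasure lebesgue (T - N) < ennreal \<delta>"
      using sets_lebesgue_outer_open[of N \<delta>] \<delta>(1) by blast
    have NT: "N \<in> lmeasurable" "measure lebesgue N = 0"
      using N negligible_iff_measure by blast+
    have Tm: "T \<in> lmeasurable"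
    proof -
      have "T = (T - N) \<union> N" using T by blast
      then show ?thesis using T NT by (metis fmeasurable.Un)
    qed
    have TD: "measure lebesgue T < \<delta>"
    proof -
      have "emeasure lebesgue (T - N) = emeasure lebesgue T"
        using Nn T(1) by (simp add: emeasure_Diff_null_set)
      then have "emeasure lebesgue T < ennreal \<delta>" using T(4) by simp
      then show ?thesis using Tm \<delta>(1) by (simp add: emeasure_eq_measure2 ennreal_less_iff)
    qed
    \<comment> \<open>A tag in the null set forces its interval into the small open set \<open>T\<close>.\<close>
    define \<gamma> where "\<gamma> x = (if x \<in> N then T else ball x (d x))" for x
    show "\<exists>\<gamma>. gauge \<gamma> \<and> (\<forall>\<D>. \<D> tagged_division_of cbox a b \<and> \<gamma> fine \<D> \<longrightarrow>
            norm ((\<Sum>(x, k)\<in>\<D>. Henstock_Kurzweil_Integration.content k *\<^sub>R g x) - (f b - f a)) < e)"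
    proof (intro exI conjI allI impI)
      show "gauge \<gamma>" using T d(1) by (auto simp: gauge_def \<gamma>_def)
      fix p assume "p tagged_division_of cbox a b \<and> \<gamma> fine p"
      then have p: "p tagged_division_of {a..b}" and fine: "\<gamma> fine p" by auto
      have ba: "b - a = (\<Sum>(x,K)\<in>p. Sup K - Inf K)" "f b - f a = (\<Sum>(x,K)\<in>p. f(Sup K) - f(Inf K))"
        using additive_tagged_division_1[where f= "\<lambda>x. x"] additive_tagged_division_1[where f= f] ab p
        by auto
      have fin: "finite p" using p by blast
      define pN where "pN = {(x,K). (x,K) \<in> p \<and> x \<in> N}"
      define pO where "pO = {(x,K). (x,K) \<in> p \<and> x \<notin> N}"
      have split: "p = pN \<union> pO" "pN \<inter> pO = {}" "finite pN" "finite pO"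
        using fin by (auto simp: pN_def pO_def intro: finite_subset[OF _ fin])
      let ?h = "\<lambda>(x,K). Henstock_Kurzweil_Integration.content K *\<^sub>R g x - (f (Sup K) - f (Inf K))"
      have ival: "\<exists>u v. K = {u..v} \<and> u \<le> v \<and> x \<in> {u..v} \<and> {u..v} \<subseteq> {a..b}" if "(x,K) \<in> p" for x K
        using p that by (metis atLeastAtMost_iff box_real(2) order_trans tagged_division_ofD(2,3,4))
      have O: "norm (sum ?h pO) \<le> e1 * (b - a)"
      proof -
        have "norm (sum ?h pO) \<le> (\<Sum>(x,K)\<in>pO. e1 * (Sup K - Inf K))"
        proof (rule sum_norm_le, safe)
          fix x K assume "(x,K) \<in> pO"
          then have xK: "(x,K) \<in> p" and xN: "x \<notin> N" by (auto simp: pO_def)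
          obtain u v where K: "K = {u..v}" "u \<le> v" "x \<in> {u..v}" "{u..v} \<subseteq> {a..b}"
            using ival[OF xK] by blast
          have sub: "{u..v} \<subseteq> ball x (d x)"
            using fineD[OF fine xK] xN K(1) by (simp add: \<gamma>_def)
          have xa: "x \<in> {a..b} - N" using K xN by auto
          have u: "norm (f u - f x - (u - x) *\<^sub>R f' x) \<le> e1 * norm (u - x)"
            using K subsetD[OF sub, of u] by (intro d(2)[OF xa]) (auto simp: dist_real_def)
          have v: "norm (f v - f x - (v - x) *\<^sub>R f' x) \<le> e1 * norm (v - x)"
            using K subsetD[OF sub, of v] by (intro d(2)[OF xa]) (auto simp: dist_real_def)
          have "Henstock_Kurzweil_Integration.content K *\<^sub>R g x - (f (Sup K) - f (Inf K))
              = (f u - f x - (u - x) *\<^sub>R f' x) - (f v - f x - (v - x) *\<^sub>R f' x)"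
            using K xN by (auto simp: g_def algebra_simps)
          also have "norm \<dots> \<le> e1 * norm (u - x) + e1 * norm (v - x)"
            using u v norm_triangle_ineq4 by (smt (verit))
          also have "\<dots> = e1 * (Sup K - Inf K)" using K by (auto simp: algebra_simps)
          finally show "norm (Henstock_Kurzweil_Integration.content K *\<^sub>R g x - (f (Sup K) - f (Inf K))) \<le> e1 * (Sup K - Inf K)" .
        qed
        also have "\<dots> \<le> (\<Sum>(x,K)\<in>p. e1 * (Sup K - Inf K))"
        proof (rule sum_mono2[OF fin])
          show "pO \<subseteq> p" using split by blast
          fix y assume "y \<in> p - pO"
          then show "0 \<le> (case y of (x,K) \<Rightarrow> e1 * (Sup K - Inf K))"
            using ival[of "fst y" "snd y"] e1 by (auto simp: split_def)
        qed
        also have "\<dots> = e1 * (b - a)" by (simp add: ba(1) sum_distrib_left split_def)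
        finally show ?thesis .
      qed
      have Nb: "norm (sum ?h pN) < e / 2"
      proof -
        have pt: "pN tagged_partial_division_of {a..b}"
          using p split(1) by (metis Un_upper1 tagged_division_of_def tagged_partial_division_subset)
        note tag = tagged_partial_division_of_Union_self[OF pt]
        define D where "D = snd ` pN"
        have D: "D division_of \<Union>D" unfolding D_def using division_of_tagged_division[OF tag] .
        have Dab: "\<Union>D \<subseteq> {a..b}" using ival unfolding D_def pN_def by fastforce
        have DT: "\<Union>D \<subseteq> T" using fine unfolding D_def pN_def fine_def \<gamma>_def by fastforce
        have Di: "\<exists>u v. K = {u..v} \<and> u \<le> v" if "K \<in> D" for K
          using that ival unfolding D_def pN_def by fastforce
        have "((\<lambda>x. 1::real) has_integral (\<Sum>K\<in>D. Henstock_Kurzweil_Integration.content K)) (\<Union>D)"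
        proof (rule has_integral_combine_division[OF D])
          fix K assume "K \<in> D"
          then obtain u v where "K = {u..v}" using Di by blast
          then show "((\<lambda>x. 1::real) has_integral Henstock_Kurzweil_Integration.content K) K"
            using has_integral_const_real[of "1::real" u v] by simp
        qed
        moreover have "((\<lambda>x. 1::real) has_integral measure lebesgue T) T"
          using integrable_integral[OF integrable_on_const[OF Tm, of "1::real"]] lmeasure_integral[OF Tm]
          by simp
        ultimately have "(\<Sum>K\<in>D. Henstock_Kurzweil_Integration.content K) \<le> measure lebesgue T"
          using DT by (intro has_integral_subset_le) auto
        moreover have "(\<Sum>K\<in>D. Henstock_Kurzweil_Integration.content K) = (\<Sum>K\<in>D. Sup K - Inf K)"
          using Di by (intro sum.cong) fastforce+
        ultimately have "(\<Sum>K\<in>D. norm (f (Sup K) - f (Inf K))) < e / 2"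
          using TD D Dab by (intro \<delta>(2)) auto
        moreover have "(\<Sum>(x,K)\<in>pN. norm (f (Sup K) - f (Inf K))) = (\<Sum>K\<in>D. norm (f (Sup K) - f (Inf K)))"
        proof -
          \<comment> \<open>The transfer of sums to the set of intervals also looks at the empty interval, where \<open>Sup\<close> and \<open>Inf\<close> are junk.\<close>
          define d where "d K = (if K = {} then 0 else norm (f (Sup K) - f (Inf K)))" for K
          have "(\<Sum>(x,K)\<in>pN. d K) = (\<Sum>K\<in>D. d K)"
            unfolding D_def
          proof (rule sum.over_tagged_division_lemma[OF tag])
            fix u v :: real assume "box u v = {}"
            then show "d (cbox u v) = 0" by (cases "u = v") (auto simp: d_def)
          qed
          moreover have "d K = norm (f (Sup K) - f (Inf K))" if "K \<in> D" for K
            using Di[OF that] by (auto simp: d_def)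
          moreover have "(\<Sum>(x,K)\<in>pN. d K) = (\<Sum>(x,K)\<in>pN. norm (f (Sup K) - f (Inf K)))"
            using calculation(2) by (intro sum.cong) (force simp: D_def)+
          ultimately show ?thesis by simp
        qed
        moreover have "norm (sum ?h pN) \<le> (\<Sum>(x,K)\<in>pN. norm (f (Sup K) - f (Inf K)))"
          by (rule sum_norm_le) (auto simp: pN_def g_def norm_minus_commute)
        ultimately show ?thesis by simp
      qed
      have "(\<Sum>(x, k)\<in>p. Henstock_Kurzweil_Integration.content k *\<^sub>R g x) - (f b - f a) = sum ?h p"
        unfolding ba(2) by (simp add: sum_subtractf[symmetric] split_def)
      also have "\<dots> = sum ?h pN + sum ?h pO"
        unfolding split(1) by (rule sum.union_disjoint[OF split(3,4,2)])
      finally have "norm ((\<Sum>(x, k)\<in>p. Henstock_Kurzweil_Integration.content k *\<^sub>R g x) - (f b - f a)) \<le> norm (sum ?h pN) + norm (sum ?h pO)"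
        by (simp add: norm_triangle_ineq)
      also have "\<dots> < e / 2 + e1 * (b - a)" using Nb O by simp
      also have "\<dots> \<le> e" using e ab by (simp add: e1_def field_simps)
      finally show "norm ((\<Sum>(x, k)\<in>p. Henstock_Kurzweil_Integration.content k *\<^sub>R g x) - (f b - f a)) < e" .
    qed
  qed
  then have "(g has_integral (f b - f a)) {a..b}" by simp
  then show ?thesis
    by (rule has_integral_spike[OF N, rotated]) (auto simp: g_def)
qed

lemma absolutely_continuous_on_subset:
  assumes "absolutely_continuous_on S f" "T \<subseteq> S"
  shows "absolutely_continuous_on T f"
  using assms unfolding absolutely_continuous_on_def by (meson order_trans)

lemma absolutely_continuous_on_imp_continuous:
  fixes f :: "real \<Rightarrow> 'a::real_normed_vector"
  assumes ac: "absolutely_continuous_on {a..b} f"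
  shows "continuous_on {a..b} f"
proof (rule continuous_onI)
  fix x e :: real assume x: "x \<in> {a..b}" and e: "e > 0"
  obtain \<delta> where \<delta>: "\<delta> > 0" "\<And>D. \<lbrakk>D division_of \<Union>D; \<Union>D \<subseteq> {a..b}; (\<Sum>k\<in>D. Sup k - Inf k) < \<delta>\<rbrakk>
        \<Longrightarrow> (\<Sum>k\<in>D. norm (f (Sup k) - f (Inf k))) < e"
      using ac e unfolding absolutely_continuous_on_def by meson
  have "dist (f x') (f x) \<le> e" if "x' \<in> {a..b}" "dist x' x < \<delta>" for x'
  proof -
    let ?K = "{min x x'..max x x'}"
    have "(\<Sum>k\<in>{?K}. norm (f (Sup k) - f (Inf k))) < e"
    proof (rule \<delta>(2))
      show "{?K} division_of \<Union>{?K}"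
        using division_of_self[of "min x x'" "max x x'"] by (simp add: cbox_division_memE)
    qed (use x that in \<open>auto simp: dist_real_def\<close>)
    then show ?thesis by (auto simp: dist_norm norm_minus_commute min_def max_def split: if_splits)
  qed
  with \<delta>(1) show "\<exists>d>0. \<forall>x'\<in>{a..b}. dist x' x < d \<longrightarrow> dist (f x') (f x) \<le> e" by blast
qed

lemma absolutely_continuous_on_diff_linear:
  assumes f: "absolutely_continuous_on S f" and g: "absolutely_continuous_on S g"
    and L: "bounded_linear L"
  shows "absolutely_continuous_on S (\<lambda>x. f x - L (g x))"
  unfolding absolutely_continuous_on_def
proof (intro allI impI)
  fix e :: real assume e: "e > 0"
  obtain B where B: "B > 0" "\<And>x. norm (L x) \<le> norm x * B"
    using bounded_linear.pos_bounded[OF L] by blast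
  obtain d1 where d1: "d1 > 0" "\<And>D. \<lbrakk>D division_of \<Union>D; \<Union>D \<subseteq> S; (\<Sum>k\<in>D. Sup k - Inf k) < d1\<rbrakk>
        \<Longrightarrow> (\<Sum>k\<in>D. norm (f (Sup k) - f (Inf k))) < e / 2"
      using f e unfolding absolutely_continuous_on_def by (meson half_gt_zero)
  have "e / (2 * B) > 0" using e B by simp
  then obtain d2 where d2: "d2 > 0" "\<And>D. \<lbrakk>D division_of \<Union>D; \<Union>D \<subseteq> S; (\<Sum>k\<in>D. Sup k - Inf k) < d2\<rbrakk>
        \<Longrightarrow> (\<Sum>k\<in>D. norm (g (Sup k) - g (Inf k))) < e / (2 * B)"
      using g unfolding absolutely_continuous_on_def by meson
  show "\<exists>\<delta>>0. \<forall>D. D division_of \<Union> D \<and> \<Union> D \<subseteq> S \<and> (\<Sum>k\<in>D. Sup k - Inf k) < \<delta> \<longrightarrow>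
          (\<Sum>k\<in>D. norm (f (Sup k) - L (g (Sup k)) - (f (Inf k) - L (g (Inf k))))) < e"
  proof (intro exI[of _ "min d1 d2"] conjI allI impI)
    show "min d1 d2 > 0" using d1 d2 by simp
    fix D assume D: "D division_of \<Union> D \<and> \<Union> D \<subseteq> S \<and> (\<Sum>k\<in>D. Sup k - Inf k) < min d1 d2"
    have "(\<Sum>k\<in>D. norm (f (Sup k) - L (g (Sup k)) - (f (Inf k) - L (g (Inf k)))))
        \<le> (\<Sum>k\<in>D. norm (f (Sup k) - f (Inf k)) + norm (g (Sup k) - g (Inf k)) * B)"
    proof (rule sum_mono)
      fix k
      have "f (Sup k) - L (g (Sup k)) - (f (Inf k) - L (g (Inf k)))
          = (f (Sup k) - f (Inf k)) - L (g (Sup k) - g (Inf k))"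
        by (simp add: linear_diff[OF bounded_linear.linear[OF L]])
      also have "norm \<dots> \<le> norm (f (Sup k) - f (Inf k)) + norm (g (Sup k) - g (Inf k)) * B"
        using B(2) norm_triangle_ineq4 by (smt (verit))
      finally show "norm (f (Sup k) - L (g (Sup k)) - (f (Inf k) - L (g (Inf k)))) \<le> \<dots>" .
    qed
    also have "\<dots> = (\<Sum>k\<in>D. norm (f (Sup k) - f (Inf k))) + (\<Sum>k\<in>D. norm (g (Sup k) - g (Inf k))) * B"
      by (simp add: sum.distrib sum_distrib_right)
    also have "\<dots> < e / 2 + e / (2 * B) * B"
      using D d1(2)[of D] d2(2)[of D] B(1) by (intro add_strict_mono mult_strict_right_mono) auto
    also have "\<dots> = e" using B(1) by simp
    finally show "(\<Sum>k\<in>D. norm (f (Sup k) - L (g (Sup k)) - (f (Inf k) - L (g (Inf k))))) < e" .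
  qed
qed

text \<open>
  Gronwall's argument with an integrable coefficient \<open>k\<close>. On an interval where \<open>k\<close> has integral less than
  \<open>1/2\<close> and at whose left end \<open>Y\<close> vanishes, the maximum \<open>m\<close> of \<open>norm Y\<close> satisfies \<open>m \<le> m/2\<close>, so \<open>Y\<close> vanishes
  on the whole interval. The primitive of \<open>k\<close> is uniformly continuous, so finitely many such intervals
  of a fixed length cover \<open>{a..b}\<close>.
\<close>
lemma linear_differential_inequality_unique:
  fixes Y :: "real \<Rightarrow> 'a::euclidean_space" and k :: "real \<Rightarrow> real"
  assumes ac: "absolutely_continuous_on {a..b} Y" and Y0: "Y a = 0"
    and k: "k integrable_on {a..b}" "\<And>x. x \<in> {a..b} \<Longrightarrow> 0 \<le> k x"
    and ae: "AE x in lebesgue_on {a..b}.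
      \<exists>Y'. (Y has_vector_derivative Y') (at x within {a..b}) \<and> norm Y' \<le> k x * norm (Y x)"
    and x: "x \<in> {a..b}"
  shows "Y x = 0"
proof -
  have cont: "continuous_on {a..b} Y" by (rule absolutely_continuous_on_imp_continuous[OF ac])
  have "AE x in lebesgue. x \<in> {a..b} \<longrightarrow>
      (\<exists>Y'. (Y has_vector_derivative Y') (at x within {a..b}) \<and> norm Y' \<le> k x * norm (Y x))"
    using ae by (subst (asm) AE_restrict_space_iff) auto
  then obtain N where N: "negligible N" "\<And>x. x \<in> {a..b} - N \<Longrightarrow>
       \<exists>Y'. (Y has_vector_derivative Y') (at x within {a..b}) \<and> norm Y' \<le> k x * norm (Y x)"
    unfolding eventually_ae_filter_negligible by blast
  then obtain Y' where Y': "\<And>x. x \<in> {a..b} - N \<Longrightarrow> (Y has_vector_derivative Y' x) (at x within {a..b})"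
      "\<And>x. x \<in> {a..b} - N \<Longrightarrow> norm (Y' x) \<le> k x * norm (Y x)"
    by metis
  define Z where "Z x = (if x \<in> N then 0 else Y' x)" for x
  have Zb: "norm (Z x) \<le> k x * norm (Y x)" if "x \<in> {a..b}" for x
    using Y'(2)[of x] k(2)[of x] that by (auto simp: Z_def)
  have ftc: "(Z has_integral (Y d - Y c)) {c..d}" if "a \<le> c" "c \<le> d" "d \<le> b" for c d
  proof (rule absolutely_continuous_FTC[OF _ that(2) N(1)])
    show "absolutely_continuous_on {c..d} Y"
      using absolutely_continuous_on_subset[OF ac] that by auto
    show "(Y has_vector_derivative Z x) (at x within {c..d})" if "x \<in> {c..d} - N" for x
      using Y'(1)[of x] that \<open>a \<le> c\<close> \<open>d \<le> b\<close>
      by (auto simp: Z_def intro: has_vector_derivative_within_subset)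
  qed
  define G where "G t = integral {a..t} k" for t
  have "uniformly_continuous_on {a..b} G"
    unfolding G_def using indefinite_integral_continuous_1[OF k(1)]
    by (intro compact_uniformly_continuous) auto
  then obtain r where r: "r > 0" "\<And>s t. \<lbrakk>s \<in> {a..b}; t \<in> {a..b}; dist t s < r\<rbrakk> \<Longrightarrow> dist (G t) (G s) < 1/2"
    unfolding uniformly_continuous_on_def by (metis half_gt_zero zero_less_one)
  have step: "\<forall>t\<in>{c..d}. Y t = 0" if cd: "a \<le> c" "c \<le> d" "d \<le> b" "d - c < r" and Yc: "Y c = 0" for c d
  proof -
    have kc: "k integrable_on {c..d}" using k(1) cd integrable_on_subinterval by (metis atLeastatMost_subset_iff)
    have "integral {c..d} k = G d - G c"
      unfolding G_def
      using Henstock_Kurzweil_Integration.integral_combine[of a c d k] cd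
        integrable_on_subinterval[OF k(1), of a d] by simp
    also have "\<dots> < 1/2" using r(2)[of c d] cd abs_ge_self[of "G d - G c"] by (simp add: dist_real_def)
    finally have half: "integral {c..d} k < 1/2" .
    have "continuous_on {c..d} (\<lambda>t. norm (Y t))"
      using cont cd by (auto intro!: continuous_intros intro: continuous_on_subset)
    then obtain m where m: "m \<in> {c..d}" "\<And>t. t \<in> {c..d} \<Longrightarrow> norm (Y t) \<le> norm (Y m)"
      using continuous_attains_sup[of "{c..d}" "\<lambda>t. norm (Y t)"] cd by auto
    have km: "k integrable_on {c..m}" using kc m(1) by (auto intro: integrable_on_subinterval)
    have Zi: "(Z has_integral Y m) {c..m}" using ftc[of c m] cd m(1) Yc by simp
    have "norm (Y m) = norm (integral {c..m} Z)" using Zi by (simp add: integral_unique)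
    also have "\<dots> \<le> integral {c..m} (\<lambda>t. k t * norm (Y m))"
    proof (rule integral_norm_bound_integral)
      show "Z integrable_on {c..m}" using Zi by blast
      show "(\<lambda>t. k t * norm (Y m)) integrable_on {c..m}"
        using km by (rule integrable_on_mult_left)
      fix t assume t: "t \<in> {c..m}"
      then have "norm (Z t) \<le> k t * norm (Y t)" using cd m(1) by (intro Zb) auto
      also have "\<dots> \<le> k t * norm (Y m)"
        using t m cd by (intro mult_left_mono k(2) m(2)) auto
      finally show "norm (Z t) \<le> k t * norm (Y m)" .
    qed
    also have "\<dots> = integral {c..m} k * norm (Y m)" by simp
    also have "\<dots> \<le> integral {c..d} k * norm (Y m)"
    proof (rule mult_right_mono)
      show "integral {c..m} k \<le> integral {c..d} k"
        using m(1) cd k(2) by (intro integral_subset_le km kc) auto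
    qed simp
    finally have "norm (Y m) \<le> integral {c..d} k * norm (Y m)" .
    moreover have "integral {c..d} k * norm (Y m) \<le> 1/2 * norm (Y m)"
      using half by (intro mult_right_mono) auto
    ultimately have "norm (Y m) = 0" using norm_ge_zero[of "Y m"] by linarith
    then show ?thesis using m(2) by (auto simp: dest!: m(2))
  qed
  \<comment> \<open>Steps of half the admissible length \<open>r\<close> make the bound in \<open>step\<close> strict.\<close>
  have reach: "\<forall>t\<in>{a..min b (a + n * (r / 2))}. Y t = 0" for n :: nat
  proof (induction n)
    case 0
    show ?case using Y0 by auto
  next
    case (Suc n)
    let ?c = "min b (a + n * (r / 2))" and ?d = "min b (a + Suc n * (r / 2))"
    have "a \<le> b" using x by auto
    then have ac: "a \<le> ?c" using r by simp
    have "?c \<le> ?d" "?d \<le> b" "?d - ?c < r"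
      using r(1) by (auto simp: min_def field_simps)
    moreover have "Y ?c = 0" using Suc ac by auto
    ultimately have "\<forall>t\<in>{?c..?d}. Y t = 0"
      by (intro step ac)
    moreover have "{a..?d} \<subseteq> {a..?c} \<union> {?c..?d}" by auto
    ultimately show ?case using Suc by blast
  qed
  obtain n :: nat where "real n > (b - a) / (r / 2)" using reals_Archimedean2 by blast
  then have "b \<le> a + n * (r / 2)" using r by (simp add: field_simps)
  then show ?thesis using reach[of n] x by auto
qed


section \<open>Legendre polynomials\<close>

definition poly_integral :: "real poly \<Rightarrow> real" where
  "poly_integral p = integral {-1..1} (poly p)"

lemma poly_integrable: "poly p integrable_on {a..b}" for p :: "real poly"
  by (intro integrable_continuous_real continuous_intros)

lemma poly_integral_add: "poly_integral (p + q) = poly_integral p + poly_integral q"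
  unfolding poly_integral_def poly_add by (intro integral_add poly_integrable)

lemma poly_integral_diff: "poly_integral (p - q) = poly_integral p - poly_integral q"
  unfolding poly_integral_def poly_diff by (intro integral_diff poly_integrable)

lemma poly_integral_smult: "poly_integral (smult c p) = c * poly_integral p"
  unfolding poly_integral_def poly_smult by simp

lemma poly_integral_0 [simp]: "poly_integral 0 = 0"
  using poly_integral_smult[of 0 0] by simp

lemma poly_integral_pderiv: "poly_integral (pderiv p) = poly p 1 - poly p (-1)"
proof -
  have "(poly (pderiv p) has_integral (poly p 1 - poly p (-1))) {-1..1}"
    by (rule fundamental_theorem_of_calculus)
       (auto simp: has_real_derivative_iff_has_vector_derivative[symmetric]
          intro: has_field_derivative_at_within)
  then show ?thesis unfolding poly_integral_def by (rule integral_unique)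
qed

lemma poly_integral_by_parts:
  assumes "poly p 1 = 0" "poly p (-1) = 0"
  shows "poly_integral (pderiv p * q) = - poly_integral (p * pderiv q)"
proof -
  have "poly_integral (pderiv (p * q)) = 0"
    using assms by (simp add: poly_integral_pderiv)
  then show ?thesis
    by (simp add: pderiv_mult poly_integral_add mult.commute)
qed

abbreviation (input) rodrigues_base :: "real poly" where "rodrigues_base \<equiv> [:-1, 0, 1:]"

text \<open>
  Each differentiation costs one factor \<open>w\<close>. For \<open>w = s\<^sup>2 - 1\<close>, which is zero at both ends
  of \<open>{-1..1}\<close>, this makes the boundary terms vanish when Rodrigues' formula is integrated by parts.
\<close>
lemma power_dvd_higher_pderiv:
  fixes w :: "'a::{comm_semiring_1,semiring_no_zero_divisors} poly"
  shows "w ^ (n - k) dvd (pderiv ^^ k) (w ^ n)"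
proof (induction k)
  case (Suc k)
  then obtain r where r: "(pderiv ^^ k) (w ^ n) = w ^ (n - k) * r" by (elim dvdE)
  show ?case
  proof (cases "n \<le> k")
    case False
    then have "n - k = Suc (n - Suc k)" by simp
    then show ?thesis by (auto simp: r pderiv_mult pderiv_power_Suc simp del: power_Suc intro!: dvd_add dvd_smult dvd_mult2 dvd_mult[of _ _ r] intro: le_imp_power_dvd)

  qed auto
qed auto

lemma poly_integral_rodrigues:
  "poly_integral ((pderiv ^^ n) (rodrigues_base ^ n) * q)
     = (-1) ^ n * poly_integral (rodrigues_base ^ n * (pderiv ^^ n) q)"
proof -
  have "poly_integral ((pderiv ^^ n) (rodrigues_base ^ n) * q)
     = (-1) ^ k * poly_integral ((pderiv ^^ (n - k)) (rodrigues_base ^ n) * (pderiv ^^ k) q)" if "k \<le> n" for k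
    using that
  proof (induction k)
    case (Suc k)
    let ?p = "(pderiv ^^ (n - Suc k)) (rodrigues_base ^ n)"
    have eq: "n - k = Suc (n - Suc k)" using Suc.prems by simp
    have "rodrigues_base ^ (n - (n - Suc k)) dvd ?p" by (rule power_dvd_higher_pderiv)
    moreover have "rodrigues_base dvd rodrigues_base ^ (n - (n - Suc k))"
      using Suc.prems by (intro dvd_power) auto
    ultimately have "rodrigues_base dvd ?p" by (rule dvd_trans[rotated])
    then have "poly ?p 1 = 0" "poly ?p (-1) = 0" by (auto elim!: dvdE)
    from poly_integral_by_parts[OF this] have
      "poly_integral ((pderiv ^^ (n - k)) (rodrigues_base ^ n) * (pderiv ^^ k) q)
        = - poly_integral (?p * (pderiv ^^ Suc k) q)"
      unfolding eq by simp
    with Suc show ?case by simp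
  qed simp
  from this[of n] show ?thesis by simp
qed

lemma Gamma_half_plus_nat: "Gamma (real k + 1/2) = fact (2*k) * sqrt pi / (4 ^ k * fact k)"
proof (induction k)
  case (Suc k)
  have "Gamma (real (Suc k) + 1/2) = (real k + 1/2) * Gamma (real k + 1/2)"
    using Gamma_plus1[of "real k + 1/2"] nonpos_Ints_nonpos[of "real k + 1/2"]
    by (force simp: add_ac)
  also have "\<dots> = fact (2 * Suc k) * sqrt pi / (4 ^ Suc k * fact (Suc k))"
    unfolding Suc by (simp add: divide_simps) (simp add: algebra_simps)
  finally show ?case .
qed (simp add: Gamma_one_half_real)

text \<open>
  This is the Beta integral of \<open>(1 - s\<^sup>2)\<^sup>n s\<^sup>m\<close> up to sign. All constants below come from it: the norm of a
  Legendre polynomial (\<open>m = 0\<close>) and the coefficients of the spherical Bessel functions. Multiplying out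
  one factor \<open>s\<^sup>2 - 1\<close> turns the integral for \<open>n + 1\<close> into a difference of two integrals for \<open>n\<close>, which is the
  recursion of the Gamma quotient on the right.
\<close>
lemma poly_integral_base_power:
  "poly_integral (rodrigues_base ^ n * monom 1 m) =
     (if even m then (-1) ^ n * fact n * Gamma ((real m + 1) / 2) * rGamma (real n + (real m + 1) / 2 + 1) else 0)"
proof (induction n arbitrary: m)
  case 0
  have *: "monom 1 m = pderiv (monom (1 / real (Suc m)) (Suc m))"
    by (simp add: pderiv_monom)
  have "poly_integral (monom 1 m) = (if even m then 2 / (real m + 1) else 0)"
    unfolding * poly_integral_pderiv by (simp add: poly_monom add.commute)
  moreover have "Gamma ((real m + 1) / 2) * rGamma ((real m + 1) / 2 + 1) = 2 / (real m + 1)"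
  proof -
    let ?a = "(real m + 1) / 2"
    have "?a * rGamma (?a + 1) = rGamma ?a" by (rule rGamma_plus1)
    moreover have "?a > 0" by (simp add: add_nonneg_pos)
    then have "Gamma ?a \<noteq> 0" using Gamma_real_pos by (metis less_irrefl)
    then have "Gamma ?a * rGamma ?a = 1" by (simp add: rGamma_inverse_Gamma)
    ultimately have "?a * (Gamma ?a * rGamma (?a + 1)) = 1" by (metis mult.left_commute)
    then have "Gamma ?a * rGamma (?a + 1) = 1 / ?a" using \<open>?a > 0\<close>
      by (metis less_irrefl nonzero_eq_divide_eq mult.commute)
    then show ?thesis by simp
  qed
  ultimately show ?case by simp
next
  case (Suc n)
  have "rodrigues_base ^ Suc n * monom 1 m = rodrigues_base ^ n * monom 1 (m + 2) - rodrigues_base ^ n * monom 1 m"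
  proof -
    have "rodrigues_base = monom 1 2 - 1" by (simp add: monom_altdef numeral_2_eq_2 one_pCons)
    then have "rodrigues_base * monom 1 m = monom 1 (m + 2) - monom 1 m"
      by (simp add: algebra_simps mult_monom monom_Suc)
    then show ?thesis by (simp only: power_Suc2 mult.assoc right_diff_distrib)
  qed
  then have eq: "poly_integral (rodrigues_base ^ Suc n * monom 1 m)
     = poly_integral (rodrigues_base ^ n * monom 1 (m + 2)) - poly_integral (rodrigues_base ^ n * monom 1 m)"
    by (simp add: poly_integral_diff)
  define a where "a = (real m + 1) / 2"
  have a: "a > 0" "(real (m + 2) + 1) / 2 = a + 1" "(real m + 1) / 2 = a" by (auto simp: a_def field_simps)
  have G: "Gamma (a + 1) = a * Gamma a" using a by (intro Gamma_plus1) (auto dest: nonpos_Ints_nonpos)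
  have R: "rGamma (real n + a + 1) = (real n + a + 1) * rGamma (real n + a + 2)"
    using rGamma_plus1[of "real n + a + 1"] by (simp add: add_ac)
  show ?case
    unfolding eq Suc.IH a(2,3) using G R by (auto simp: add_ac) (auto simp: algebra_simps)
qed

lemma poly_integral_legendre:
  "poly_integral (legendre_poly n * q)
     = (-1) ^ n / (2 ^ n * fact n) * poly_integral (rodrigues_base ^ n * (pderiv ^^ n) q)"
  unfolding legendre_poly_def by (simp add: poly_integral_smult poly_integral_rodrigues)

lemma higher_pderiv_eq_0:
  fixes p :: "'a::{comm_semiring_1,semiring_no_zero_divisors,semiring_char_0} poly"
  assumes "degree p < n"
  shows "(pderiv ^^ n) p = 0"
  using assms by (intro poly_eqI) (simp add: coeff_higher_pderiv coeff_eq_0)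

text \<open>
  After \<open>n\<close> integrations by parts all derivatives fall on \<open>q\<close> and annihilate it.
\<close>
lemma legendre_orthogonal_lower_degree:
  assumes "degree q < n"
  shows "poly_integral (legendre_poly n * q) = 0"
  by (simp add: poly_integral_legendre higher_pderiv_eq_0[OF assms])

lemma degree_legendre_poly: "degree (legendre_poly n) = n"
proof -
  have "degree (rodrigues_base ^ n) = 2 * n" by (subst degree_power_eq) auto
  then show ?thesis unfolding legendre_poly_def by (simp add: degree_higher_pderiv)
qed

lemma legendre_norm: "poly_integral (legendre_poly n * legendre_poly n) = 2 / (2 * real n + 1)"
proof -
  have deg: "degree (rodrigues_base ^ n) = 2 * n" by (subst degree_power_eq) auto
  have lc: "coeff (rodrigues_base ^ n) (2 * n) = 1"
    using lead_coeff_power[of rodrigues_base n] deg by simp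
  have "(pderiv ^^ n) (legendre_poly n) = smult (1 / (2 ^ n * fact n)) ((pderiv ^^ (2 * n)) (rodrigues_base ^ n))"
    unfolding legendre_poly_def by (simp add: higher_pderiv_smult mult_2 funpow_add)
  also have "(pderiv ^^ (2 * n)) (rodrigues_base ^ n) = monom (fact (2 * n)) 0"
    by (intro poly_eqI) (auto simp: coeff_higher_pderiv lc pochhammer_fact[symmetric] coeff_eq_0 deg)
  finally have "poly_integral (legendre_poly n * legendre_poly n)
      = (-1) ^ n / (2 ^ n * fact n) * (fact (2 * n) / (2 ^ n * fact n) * poly_integral (rodrigues_base ^ n * monom 1 0))"
    by (simp add: poly_integral_legendre smult_monom monom_0 poly_integral_smult)
  also have "poly_integral (rodrigues_base ^ n * monom 1 0) = (-1) ^ n * fact n * sqrt pi * rGamma (real (Suc n) + 1/2)"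
    using poly_integral_base_power[of n 0] by (simp add: Gamma_one_half_real add_ac)
  also have "rGamma (real (Suc n) + 1/2) = 4 ^ Suc n * fact (Suc n) / (fact (2 * Suc n) * sqrt pi)"
    unfolding rGamma_inverse_Gamma Gamma_half_plus_nat by (simp add: field_simps)
  also have "(-1) ^ n / (2 ^ n * fact n) * (fact (2 * n) / (2 ^ n * fact n) * ((-1) ^ n * fact n * sqrt pi *
      (4 ^ Suc n * fact (Suc n) / (fact (2 * Suc n) * sqrt pi)))) = (2 / (2 * real n + 1)) * ((-1)^n * (-1)^n * (4^n / (2^n * 2^n)))"
    by (simp add: divide_simps) (simp add: algebra_simps)
  also have "\<dots> = 2 / (2 * real n + 1)" 
    by (simp flip: power_mult_distrib power_add)
  finally show ?thesis .
qed

lemma legendre_orthogonal: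
  "poly_integral (legendre_poly m * legendre_poly n) = (if m = n then 2 / (2 * real n + 1) else 0)"
proof (cases m n rule: linorder_cases)
  case less
  then show ?thesis
    using legendre_orthogonal_lower_degree[of "legendre_poly m" n] by (simp add: degree_legendre_poly mult.commute)
next
  case greater
  then show ?thesis
    using legendre_orthogonal_lower_degree[of "legendre_poly n" m] by (simp add: degree_legendre_poly)
qed (simp add: legendre_norm)

text \<open>
  As \<open>P\<^sub>n\<close> has degree exactly \<open>n\<close>, subtracting a multiple of it removes the leading term of a polynomial of
  degree \<open>n\<close>.
\<close>
lemma legendre_span:
  assumes "degree q < N"
  shows "\<exists>c. q = (\<Sum>n<N. smult (c n) (legendre_poly n))"
  using assms
proof (induction N arbitrary: q)
  case (Suc N)
  have l: "coeff (legendre_poly N) N \<noteq> 0"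
  proof -
    have "legendre_poly N \<noteq> 0"
      using legendre_norm[of N] by (auto simp: add_eq_0_iff)
    then show ?thesis using degree_legendre_poly[of N] by (metis leading_coeff_0_iff)
  qed
  define a where "a = coeff q N / coeff (legendre_poly N) N"
  define r where "r = q - smult a (legendre_poly N)"
  have "\<exists>c. r = (\<Sum>n<N. smult (c n) (legendre_poly n))"
  \<comment> \<open>A vanishing coefficient of index \<open>0\<close> does not lower the degree, it makes the polynomial zero.\<close>
  proof (cases "N = 0")
    case True
    have "degree r \<le> 0" unfolding r_def using Suc.prems True degree_legendre_poly[of 0]
      by (intro degree_diff_le) (auto intro: order_trans[OF degree_smult_le])
    moreover have "coeff r 0 = 0" using l True by (simp add: r_def a_def)
    ultimately have "r = 0" by (metis leading_coeff_0_iff le_zero_eq)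
    then show ?thesis using True by simp
  next
    case False
    have "degree r \<le> N" unfolding r_def using Suc.prems degree_legendre_poly[of N]
      by (intro degree_diff_le) (auto intro: order_trans[OF degree_smult_le])
    moreover have "coeff r N = 0" using l by (simp add: r_def a_def)
    ultimately have "degree r < N"
      using False by (metis leading_coeff_0_iff le_neq_implies_less degree_0 gr0I)
    then show ?thesis by (rule Suc.IH)
  qed
  then obtain c where c: "r = (\<Sum>n<N. smult (c n) (legendre_poly n))" by blast
  have "q = r + smult a (legendre_poly N)" by (simp add: r_def)
  also have "\<dots> = (\<Sum>n<Suc N. smult ((c(N := a)) n) (legendre_poly n))"
    by (simp add: c)
  finally show ?case by blast
qed simp

lemma legendre_moment:
  "poly_integral (legendre_poly n * monom 1 (n + m)) =
     (if even m then fact (n + m) / fact m / 2 ^ n * Gamma ((real m + 1) / 2) * rGamma (real n + (real m + 1) / 2 + 1) else 0)"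
proof -
  have "(pderiv ^^ n) (monom 1 (n + m)) = monom (fact (n + m) / fact m :: real) m"
  proof (rule poly_eqI)
    fix k
    have "pochhammer (real (Suc m)) n = fact (n + m) / fact m"
      using pochhammer_product'[of "1::real" m n]
      by (simp add: pochhammer_fact[symmetric] add_ac)
    then show "coeff ((pderiv ^^ n) (monom 1 (n + m))) k = coeff (monom (fact (n + m) / fact m :: real) m) k"
      by (auto simp: coeff_higher_pderiv)
  qed
  then have "(pderiv ^^ n) (monom 1 (n + m)) = smult (fact (n + m) / fact m :: real) (monom 1 m)"
    by (simp add: smult_monom)
  then show ?thesis
    by (cases "even n") (simp_all add: poly_integral_legendre poly_integral_smult poly_integral_base_power, simp_all add: mult_ac)
qed

lemma legendre_moment_lower:
  assumes "m < n" shows "poly_integral (legendre_poly n * monom 1 m) = 0"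
  using assms by (intro legendre_orthogonal_lower_degree) (simp add: degree_monom_eq)

lemma spherical_bessel_j_minus: "spherical_bessel_j n (- z) = (-1) ^ n * spherical_bessel_j n z"
  unfolding spherical_bessel_j_def by (simp add: power_mult power_minus[of "z / 2"] flip: minus_divide_left)


section \<open>Fourier transforms of Legendre polynomials\<close>

lemma continuous_imp_integrable_lebesgue_on:
  fixes f :: "real \<Rightarrow> 'a::euclidean_space"
  assumes "continuous_on {a..b} f"
  shows "integrable (lebesgue_on {a..b}) f"
  using absolutely_integrable_continuous_real[OF assms]
  by (simp add: set_integrable_def integrable_restrict_space)

lemma integral_poly_scaled:
  assumes "x > 0"
  shows "(LINT t|lebesgue_on {-x..x}. poly p (t / x)) = x * poly_integral p"
proof -
  have "(poly p has_integral poly_integral p) {-1..1}"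
    unfolding poly_integral_def using poly_integrable by blast
  from has_integral_stretch_real[OF this, of "1 / x"] assms
  have "((\<lambda>t. poly p (t / x)) has_integral x * poly_integral p) ((\<lambda>s. s * x) ` {-1..1})"
    by simp
  moreover have "(\<lambda>s. s * x) ` {-1..1} = {-x..x}"
    using image_mult_atLeastAtMost[of x "-1" 1] assms by (simp add: mult.commute[of _ x])
  ultimately have "((\<lambda>t. poly p (t / x)) has_integral x * poly_integral p) {-x..x}" by simp
  moreover have "integrable (lebesgue_on {-x..x}) (\<lambda>t. poly p (t / x))"
    using assms by (intro continuous_imp_integrable_lebesgue_on continuous_intros) auto
  ultimately show ?thesis
    by (simp add: lebesgue_integral_eq_integral integral_unique)
qed

text \<open>
  The exponential series may be integrated termwise against a polynomial on a bounded interval. The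
  powers of \<open>t\<close> are written as powers of \<open>t / x\<close>, so that each term is a moment on \<open>{-1..1}\<close>.
\<close>
lemma poly_exp_integral_sums:
  assumes x: "x > 0"
  shows "(\<lambda>m. (\<i> * z * of_real x) ^ m / fact m * of_real (x * poly_integral (p * monom 1 m))) sums
     (LINT t|lebesgue_on {-x..x}. of_real (poly p (t / x)) * exp (\<i> * (z * of_real t)))"
proof -
  let ?M = "lebesgue_on {-x..x}"
  define c where "c m = (\<i> * z * of_real x) ^ m / fact m" for m :: nat
  define a where "a m t = c m * of_real (poly (p * monom 1 m) (t / x))" for m t
  have ai: "integrable ?M (a m)" for m
    unfolding a_def using x by (intro continuous_imp_integrable_lebesgue_on continuous_intros) auto
  have "bounded (poly p ` {-1..1})"
    by (intro compact_imp_bounded compact_continuous_image continuous_intros) auto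
  then obtain B where B: "\<And>s. s \<in> {-1..1} \<Longrightarrow> \<bar>poly p s\<bar> \<le> B"
    unfolding bounded_iff by (metis imageI real_norm_def)
  have ab: "norm (a m t) \<le> norm (c m) * B" if "t \<in> {-x..x}" for m t
  proof -
    have s: "t / x \<in> {-1..1}" using that x by (auto simp: field_simps)
    then have "\<bar>poly p (t / x)\<bar> * \<bar>t / x\<bar> ^ m \<le> B * 1"
      by (intro mult_mono B power_le_one order_trans[OF abs_ge_zero B]) auto
    then show ?thesis
      unfolding a_def by (simp add: norm_mult poly_monom abs_mult power_abs mult_left_mono flip: of_real_mult)
  qed
  have cs: "summable (\<lambda>m. norm (c m))"
    unfolding c_def using summable_norm_exp[of "\<i> * z * of_real x"]
    by (simp add: norm_divide divide_inverse norm_mult norm_power norm_inverse mult.commute)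
  have csB: "summable (\<lambda>m. norm (c m) * B)" using cs by (rule summable_mult2)
  have "(\<lambda>m. integral\<^sup>L ?M (a m)) sums (LINT t|?M. (\<Sum>m. a m t))"
  proof (rule sums_integral)
    show "AE t in ?M. summable (\<lambda>m. norm (a m t))"
      using ab by (intro AE_I2 summable_comparison_test[OF _ csB]) auto
    show "summable (\<lambda>m. LINT t|?M. norm (a m t))"
    proof (rule summable_comparison_test)
      show "summable (\<lambda>m. (2 * x) * (norm (c m) * B))" using csB by (rule summable_mult)
      have "norm (LINT t|?M. norm (a m t)) \<le> (2 * x) * (norm (c m) * B)" for m
      proof -
        have "(LINT t|?M. norm (a m t)) \<le> (LINT t|?M. norm (c m) * B)"
          using ai ab by (intro integral_mono integrable_norm) (auto simp: x)
        also have "\<dots> = (2 * x) * (norm (c m) * B)" using x by (simp add: measure_restrict_space)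
        finally show ?thesis by simp
      qed
      then show "\<exists>N. \<forall>m\<ge>N. norm (LINT t|?M. norm (a m t)) \<le> (2 * x) * (norm (c m) * B)" by blast
    qed
  qed (rule ai)
  moreover have "integral\<^sup>L ?M (a m) = c m * of_real (x * poly_integral (p * monom 1 m))" for m
    unfolding a_def by (simp only: integral_mult_right_zero integral_complex_of_real integral_poly_scaled[OF x])
  moreover have "(\<Sum>m. a m t) = of_real (poly p (t / x)) * exp (\<i> * (z * of_real t))" for t
  proof -
    have "a m t = of_real (poly p (t / x)) * ((\<i> * (z * of_real t)) ^ m /\<^sub>R fact m)" for m
      using x by (simp add: a_def c_def poly_monom power_mult_distrib power_divide scaleR_conv_of_real field_simps)
    moreover have "(\<lambda>m. of_real (poly p (t / x)) * ((\<i> * (z * of_real t)) ^ m /\<^sub>R fact m)) sums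
       (of_real (poly p (t / x)) * exp (\<i> * (z * of_real t)))"
      by (intro sums_mult exp_converges)
    ultimately show ?thesis by (simp add: sums_iff)
  qed
  ultimately show ?thesis by (simp add: c_def)
qed

text \<open>
  The identity behind the whole theorem: the Fourier transform of a Legendre polynomial is a spherical
  Bessel function. Expand the exponential. The moments of the Legendre polynomial with exponent \<open>m < n\<close> or
  with \<open>m - n\<close> odd vanish, and the exponents \<open>m = n + 2 k\<close> reproduce the power series of \<open>j\<^sub>n\<close> term by term.
\<close>
lemma legendre_exp_integral:
  assumes x: "x > 0"
  shows "(LINT t|lebesgue_on {-x..x}. of_real (poly (legendre_poly n) (t / x)) * exp (\<i> * (z * of_real t)))
      = 2 * of_real x * \<i> ^ n * spherical_bessel_j n (z * of_real x)"
proof -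
  let ?f = "\<lambda>m. (\<i> * z * of_real x) ^ m / fact m * of_real (x * poly_integral (legendre_poly n * monom 1 m))"
  let ?g = "\<lambda>k. n + 2 * k"
  define u where "u = z * of_real x / 2"
  define b where "b k = (-1) ^ k * rGamma (of_nat n + 1 / 2 + of_nat k + 1 :: complex) / fact k * u ^ (2 * k)" for k
  have "?f sums (LINT t|lebesgue_on {-x..x}. of_real (poly (legendre_poly n) (t / x)) * exp (\<i> * (z * of_real t)))"
    (is "_ sums ?I") by (rule poly_exp_integral_sums[OF x])
  moreover have "?f m = 0" if "m \<notin> range ?g" for m
  proof (cases "m < n")
    case False
    then obtain k where k: "m = n + k" by (metis add_diff_inverse_nat)
    have "odd k" using that k by (auto elim!: evenE)
    then show ?thesis using legendre_moment[of n k] k by simp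
  qed (simp add: legendre_moment_lower)
  ultimately have "(\<lambda>k. ?f (?g k)) sums ?I"
    by (subst sums_mono_reindex) (auto simp: strict_mono_def)
  moreover have "?f (?g k) = (of_real (x * sqrt pi) * \<i> ^ n * u ^ n) * b k" for k
  proof -
    have m: "poly_integral (legendre_poly n * monom 1 (n + 2 * k)) =
       fact (n + 2 * k) * sqrt pi / (2 ^ n * 4 ^ k * fact k) * rGamma (real n + 1/2 + real k + 1)"
      unfolding legendre_moment using Gamma_half_plus_nat[of k]
      by (simp add: add_divide_distrib add_ac)
    have rG: "complex_of_real (rGamma (real n + 1/2 + real k + 1)) = rGamma (of_nat n + 1 / 2 + of_nat k + 1)"
      by (simp flip: rGamma_complex_of_real)
    have p: "(\<i> * z * of_real x) ^ (n + 2 * k) = \<i> ^ n * (-1) ^ k * u ^ n * u ^ (2 * k) * 2 ^ n * 4 ^ k"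
    proof -
      have eq: "\<i> * z * of_real x = \<i> * (u * 2)" by (simp add: u_def)
      show ?thesis
        unfolding eq unfolding power_mult_distrib power_add power_mult by (simp add: mult_ac)
    qed
    show ?thesis unfolding m p b_def of_real_mult of_real_divide rG by (simp add: field_simps)
  qed
  ultimately have s: "(\<lambda>k. (of_real (x * sqrt pi) * \<i> ^ n * u ^ n) * b k) sums ?I" by simp
  \<comment> \<open>When the common factor is zero, the convergence of the series \<open>b\<close> cannot be read off from \<open>s\<close>; both sides are then zero.\<close>
  show ?thesis
  proof (cases "of_real (x * sqrt pi) * \<i> ^ n * u ^ n = 0")
    case True
    have "?I = 0" using s unfolding True mult_zero_left by (simp add: sums_iff)
    moreover have "(z * of_real x / 2) ^ n = 0" using True x by (simp add: u_def)
    then have "spherical_bessel_j n (z * of_real x) = 0"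
      unfolding spherical_bessel_j_def by (simp only: mult_zero_right mult_zero_left)
    ultimately show ?thesis by simp
  next
    case False
    then have "summable b" using s by (auto simp: sums_iff summable_cmult_iff)
    then have "?I = (of_real (x * sqrt pi) * \<i> ^ n * u ^ n) * suminf b"
      using s by (simp add: sums_iff suminf_mult)
    then show ?thesis by (simp add: spherical_bessel_j_def u_def b_def[abs_def] mult_ac)
  qed
qed

lemma
  assumes x: "x > 0"
  shows legendre_cos_integral:
      "(LINT t|lebesgue_on {-x..x}. of_real (poly (legendre_poly n) (t / x)) * cos (z * of_real t))
       = (if even n then 2 * of_real x * (-1) ^ (n div 2) * spherical_bessel_j n (z * of_real x) else 0)" (is "?C = _")
    and legendre_sin_integral:
      "(LINT t|lebesgue_on {-x..x}. of_real (poly (legendre_poly n) (t / x)) * sin (z * of_real t))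
       = (if even n then 0 else 2 * of_real x * (-1) ^ (n div 2) * spherical_bessel_j n (z * of_real x))" (is "?S = _")
proof -
  let ?M = "lebesgue_on {-x..x}"
  let ?P = "\<lambda>t. complex_of_real (poly (legendre_poly n) (t / x))"
  let ?j = "spherical_bessel_j n (z * of_real x)"
  have i: "integrable ?M (\<lambda>t. ?P t * exp (\<i> * (w * of_real t)))" for w
    using x by (intro continuous_imp_integrable_lebesgue_on continuous_intros) auto
  have p: "(LINT t|?M. ?P t * exp (\<i> * (z * of_real t))) = 2 * of_real x * \<i> ^ n * ?j"
    by (rule legendre_exp_integral[OF x])
  have m: "(LINT t|?M. ?P t * exp (\<i> * (- z * of_real t))) = 2 * of_real x * \<i> ^ n * ((-1) ^ n * ?j)"
    using legendre_exp_integral[OF x, of n "- z"] by (simp add: spherical_bessel_j_minus)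
  have "?C = (LINT t|?M. (?P t * exp (\<i> * (z * of_real t)) + ?P t * exp (\<i> * (- z * of_real t))) / 2)"
    by (intro Bochner_Integration.integral_cong) (auto simp: cos_exp_eq distrib_left)
  also have "\<dots> = (2 * of_real x * \<i> ^ n * ?j + 2 * of_real x * \<i> ^ n * ((-1) ^ n * ?j)) / 2"
    by (simp only: integral_divide_zero Bochner_Integration.integral_add[OF i i] p m)
  finally have C: "?C = of_real x * \<i> ^ n * (1 + (-1) ^ n) * ?j"
    by (simp add: add_divide_distrib ring_distribs mult_ac)
  have "?S = (LINT t|?M. (?P t * exp (\<i> * (z * of_real t)) - ?P t * exp (\<i> * (- z * of_real t))) / (2 * \<i>))"
    by (intro Bochner_Integration.integral_cong) (auto simp: sin_exp_eq right_diff_distrib)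
  also have "\<dots> = (2 * of_real x * \<i> ^ n * ?j - 2 * of_real x * \<i> ^ n * ((-1) ^ n * ?j)) / (2 * \<i>)"
    by (simp only: integral_divide_zero Bochner_Integration.integral_diff[OF i i] p m)
  also have "\<dots> = of_real x * (\<i> ^ n / \<i>) * (1 - (-1) ^ n) * ?j"
  proof -
    have "(2 * a * b * e - 2 * a * b * (c * e)) / (2 * \<i>) = a * (b / \<i>) * (1 - c) * e" for a b c e :: complex
      by (simp add: field_simps)
    then show ?thesis .
  qed
  finally have S: "?S = of_real x * (\<i> ^ n / \<i>) * (1 - (-1) ^ n) * ?j" .
  show "?C = (if even n then 2 * of_real x * (-1) ^ (n div 2) * ?j else 0)"
    unfolding C by (auto elim!: evenE simp: power_mult)
  show "?S = (if even n then 0 else 2 * of_real x * (-1) ^ (n div 2) * ?j)"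
  proof (cases "even n")
    case False
    then obtain k where n: "n = 2 * k + 1" by (elim oddE)
    show ?thesis unfolding S by (simp add: n power_mult)
  qed (simp add: S)
qed


section \<open>Square integrable functions\<close>

lemma norm_add_power2_le:
  fixes a b :: "'a::real_normed_vector"
  shows "(norm (a + b))\<^sup>2 \<le> 2 * (norm a)\<^sup>2 + 2 * (norm b)\<^sup>2"
proof -
  have "(norm (a + b))\<^sup>2 \<le> (norm a + norm b)\<^sup>2" by (intro power_mono norm_triangle_ineq) auto
  also have "\<dots> \<le> 2 * (norm a)\<^sup>2 + 2 * (norm b)\<^sup>2"
    using sum_squares_bound[of "norm a" "norm b"] by (simp add: power2_sum)
  finally show ?thesis .
qed

lemma square_integrable_on_add:
  fixes f g :: "real \<Rightarrow> 'a::{real_normed_vector, second_countable_topology}"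
  assumes "f square_integrable_on S" "g square_integrable_on S"
  shows "(\<lambda>t. f t + g t) square_integrable_on S"
proof -
  have [measurable]: "f \<in> borel_measurable (lebesgue_on S)" "g \<in> borel_measurable (lebesgue_on S)"
    using assms by (auto simp: square_integrable_on_def)
  have "integrable (lebesgue_on S) (\<lambda>t. (norm (f t + g t))\<^sup>2)"
  proof (rule Bochner_Integration.integrable_bound)
    show "integrable (lebesgue_on S) (\<lambda>t. 2 * (norm (f t))\<^sup>2 + 2 * (norm (g t))\<^sup>2)"
      using assms by (auto simp: square_integrable_on_def)
  qed (use norm_add_power2_le in \<open>auto intro!: AE_I2\<close>)
  then show ?thesis by (simp add: square_integrable_on_def)
qed

lemma square_integrable_on_cmult:
  fixes f :: "real \<Rightarrow> complex"
  assumes "f square_integrable_on S"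
  shows "(\<lambda>t. c * f t) square_integrable_on S"
  using assms by (auto simp: square_integrable_on_def norm_mult power_mult_distrib)

lemma square_integrable_on_diff:
  fixes f g :: "real \<Rightarrow> complex"
  assumes "f square_integrable_on S" "g square_integrable_on S"
  shows "(\<lambda>t. f t - g t) square_integrable_on S"
  using square_integrable_on_add[OF assms(1) square_integrable_on_cmult[OF assms(2), of "-1"]] by simp

lemma square_integrable_on_continuous:
  fixes f :: "real \<Rightarrow> 'a::euclidean_space"
  assumes "continuous_on {a..b} f"
  shows "f square_integrable_on {a..b}"
  using assms unfolding square_integrable_on_def
  by (auto intro!: continuous_imp_integrable_lebesgue_on continuous_intros
     borel_measurable_integrable)

lemma square_integrable_on_mult_integrable:
  fixes f g :: "real \<Rightarrow> complex"
  assumes "f square_integrable_on S" "g square_integrable_on S"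
  shows "integrable (lebesgue_on S) (\<lambda>t. f t * g t)"
proof (rule Bochner_Integration.integrable_bound)
  show "integrable (lebesgue_on S) (\<lambda>t. (norm (f t))\<^sup>2 + (norm (g t))\<^sup>2)"
    using assms by (auto simp: square_integrable_on_def)
  show "(\<lambda>t. f t * g t) \<in> borel_measurable (lebesgue_on S)"
    using assms by (auto simp: square_integrable_on_def)
  have "norm (f t) * norm (g t) \<le> (norm (f t))\<^sup>2 + (norm (g t))\<^sup>2" for t
    using sum_squares_bound[of "norm (f t)" "norm (g t)"]
      mult_nonneg_nonneg[OF norm_ge_zero norm_ge_zero, of "f t" "g t"] by linarith
  then show "AE t in lebesgue_on S. norm (f t * g t) \<le> norm ((norm (f t))\<^sup>2 + (norm (g t))\<^sup>2)"
    by (intro AE_I2) (simp add: norm_mult)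
qed

lemma square_integrable_Cauchy_Schwarz:
  fixes f g :: "real \<Rightarrow> complex"
  assumes f: "f square_integrable_on S" and g: "g square_integrable_on S"
  shows "norm (LINT t|lebesgue_on S. f t * g t)
     \<le> sqrt (LINT t|lebesgue_on S. (norm (f t))\<^sup>2) * sqrt (LINT t|lebesgue_on S. (norm (g t))\<^sup>2)"
proof -
  let ?M = "lebesgue_on S"
  have m[measurable]: "f \<in> borel_measurable ?M" "g \<in> borel_measurable ?M"
    and i: "integrable ?M (\<lambda>t. (norm (f t))\<^sup>2)" "integrable ?M (\<lambda>t. (norm (g t))\<^sup>2)"
    using f g by (auto simp: square_integrable_on_def)
  define F where "F = (LINT t|?M. (norm (f t))\<^sup>2)"
  define G where "G = (LINT t|?M. (norm (g t))\<^sup>2)"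
  define I where "I = (LINT t|?M. norm (f t * g t))"
  have nn: "F \<ge> 0" "G \<ge> 0" "I \<ge> 0" by (auto simp: F_def G_def I_def)
  have "(\<integral>\<^sup>+t. ennreal (norm (f t)) * ennreal (norm (g t)) \<partial>?M)\<^sup>2
      \<le> (\<integral>\<^sup>+t. (ennreal (norm (f t)))\<^sup>2 \<partial>?M) * (\<integral>\<^sup>+t. (ennreal (norm (g t)))\<^sup>2 \<partial>?M)"
    by (rule Cauchy_Schwarz_nn_integral) auto
  moreover have "(\<integral>\<^sup>+t. ennreal (norm (f t)) * ennreal (norm (g t)) \<partial>?M) = ennreal I"
    unfolding I_def using integrable_norm[OF square_integrable_on_mult_integrable[OF f g]]
    by (subst nn_integral_eq_integral[symmetric]) (auto simp: norm_mult ennreal_mult)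
  moreover have "(\<integral>\<^sup>+t. (ennreal (norm (f t)))\<^sup>2 \<partial>?M) = ennreal F"
    unfolding F_def using i by (subst nn_integral_eq_integral[symmetric]) (auto simp: ennreal_power)
  moreover have "(\<integral>\<^sup>+t. (ennreal (norm (g t)))\<^sup>2 \<partial>?M) = ennreal G"
    unfolding G_def using i by (subst nn_integral_eq_integral[symmetric]) (auto simp: ennreal_power)
  ultimately have "ennreal (I\<^sup>2) \<le> ennreal (F * G)"
    using nn by (simp add: ennreal_power ennreal_mult)
  then have "I\<^sup>2 \<le> F * G" using nn by simp
  then have "I \<le> sqrt F * sqrt G"
    using nn by (metis real_le_rsqrt real_sqrt_mult)
  moreover have "norm (LINT t|?M. f t * g t) \<le> I"
    unfolding I_def by (rule integral_norm_bound)
  ultimately show ?thesis by (simp add: F_def G_def)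
qed

text \<open>
  For \<open>m > 0\<close> this is the radial projection onto the ball of radius \<open>m\<close>; the formula makes its continuity visible.
\<close>
definition truncate :: "real \<Rightarrow> 'a::real_normed_vector \<Rightarrow> 'a" where
  "truncate m v = (m / max m (norm v)) *\<^sub>R v"

lemma norm_truncate_le:
  assumes "m > 0"
  shows "norm (truncate m v) \<le> m" "norm (truncate m v) \<le> norm v"
  using assms by (auto simp: truncate_def max_def divide_simps)

lemma truncate_eq: "0 < m \<Longrightarrow> norm v \<le> m \<Longrightarrow> truncate m v = v"
  by (simp add: truncate_def max_def)

lemma continuous_on_truncate:
  fixes f :: "'b::topological_space \<Rightarrow> 'a::real_normed_vector"
  assumes "m > 0" "continuous_on S f"
  shows "continuous_on S (\<lambda>t. truncate m (f t))"
  unfolding truncate_def using assms by (intro continuous_intros) (auto simp: max_def)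

text \<open>
  Three approximations, each close in mean square. Truncation makes \<open>f\<close> bounded (dominated convergence,
  with a multiple of \<open>(norm f)\<^sup>2\<close> as majorant). A measurable function is almost everywhere a limit of continuous ones, and
  after truncating those as well the constants dominate. A continuous function is uniformly close to
  a polynomial by the Stone-Weierstrass theorem.
\<close>
lemma polynomial_dense_square_integrable:
  fixes f :: "real \<Rightarrow> 'a::euclidean_space"
  assumes f: "f square_integrable_on {a..b}" and e: "e > 0"
  shows "\<exists>g. polynomial_function g \<and> (LINT t|lebesgue_on {a..b}. (norm (f t - g t))\<^sup>2) < e"
proof -
  let ?M = "lebesgue_on {a..b}"
  have fm[measurable]: "f \<in> borel_measurable ?M" and fi: "integrable ?M (\<lambda>t. (norm (f t))\<^sup>2)"
    using f by (auto simp: square_integrable_on_def)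
  have cm: "(\<lambda>t. truncate m (h t)) \<in> borel_measurable ?M" if "m > 0" "h \<in> borel_measurable ?M" for m and h :: "real \<Rightarrow> 'a"
    using measurable_compose[OF that(2) borel_measurable_continuous_onI[OF continuous_on_truncate[OF that(1) continuous_on_id]]]
    by simp
  have le: "(norm (u - v))\<^sup>2 \<le> 2 * (norm u)\<^sup>2 + 2 * (norm v)\<^sup>2" for u v :: 'a
    using norm_add_power2_le[of u "- v"] by simp
  interpret finite_measure ?M by (rule finite_measure_lebesgue_on) auto
  have "(\<lambda>n. LINT t|?M. (norm (f t - truncate (real (Suc n)) (f t)))\<^sup>2) \<longlonglongrightarrow> (LINT t|?M. 0)"
  proof (rule integral_dominated_convergence)
    show "integrable ?M (\<lambda>t. 4 * (norm (f t))\<^sup>2)" using fi by simp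
    show "(\<lambda>t. (norm (f t - truncate (real (Suc n)) (f t)))\<^sup>2) \<in> borel_measurable ?M" for n
      using cm[OF _ fm, of "real (Suc n)"] by measurable
    show "AE t in ?M. (\<lambda>n. (norm (f t - truncate (real (Suc n)) (f t)))\<^sup>2) \<longlonglongrightarrow> 0"
    proof (intro AE_I2)
      fix t
      obtain n0 :: nat where "norm (f t) \<le> real n0" using real_arch_simple by blast
      then have "eventually (\<lambda>n. (norm (f t - truncate (real (Suc n)) (f t)))\<^sup>2 = 0) sequentially"
        by (intro eventually_sequentiallyI[of n0]) (simp add: truncate_eq)
      then show "(\<lambda>n. (norm (f t - truncate (real (Suc n)) (f t)))\<^sup>2) \<longlonglongrightarrow> 0"
        by (rule tendsto_eventually)
    qed
    fix n
    have "(norm (f t - truncate (real (Suc n)) (f t)))\<^sup>2 \<le> 4 * (norm (f t))\<^sup>2" for t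
    proof -
      have "(norm (truncate (real (Suc n)) (f t)))\<^sup>2 \<le> (norm (f t))\<^sup>2"
        by (intro power_mono norm_truncate_le) auto
      then show ?thesis using le[of "f t" "truncate (real (Suc n)) (f t)"] by linarith
    qed
    then show "AE t in ?M. norm ((norm (f t - truncate (real (Suc n)) (f t)))\<^sup>2) \<le> 4 * (norm (f t))\<^sup>2"
      by (intro AE_I2) simp
  qed auto
  then have "eventually (\<lambda>n. (LINT t|?M. (norm (f t - truncate (real (Suc n)) (f t)))\<^sup>2) < e / 8) sequentially"
    using e by (intro order_tendstoD(2)) auto
  then obtain n where n: "(LINT t|?M. (norm (f t - truncate (real (Suc n)) (f t)))\<^sup>2) < e / 8"
    by (auto simp: eventually_sequentially)
  define m where "m = real (Suc n)"
  have m: "m > 0" by (simp add: m_def)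
  have "f measurable_on {a..b}" using fm by (simp add: measurable_on_iff_borel_measurable)
  then obtain N g where N: "negligible N" and gc: "\<And>k. continuous_on UNIV (g k)"
    and glim: "\<And>t. t \<notin> N \<Longrightarrow> (\<lambda>k. g k t) \<longlonglongrightarrow> (if t \<in> {a..b} then f t else 0)"
    unfolding measurable_on_def by blast
  have gm: "g k \<in> borel_measurable ?M" for k
    using gc[of k] by (intro measurable_restrict_space1 measurable_completion) (auto intro: borel_measurable_continuous_onI)
  have AEN: "AE t in ?M. t \<notin> N"
    using N by (intro AE_restrict_space_iff[THEN iffD2]) (auto simp: negligible_iff_null_sets AE_not_in eventually_mono[OF AE_not_in])
  have "(\<lambda>k. LINT t|?M. (norm (truncate m (f t) - truncate m (g k t)))\<^sup>2) \<longlonglongrightarrow> (LINT t|?M. 0)"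
  proof (rule integral_dominated_convergence)
    show "integrable ?M (\<lambda>t. 4 * m\<^sup>2)" by simp
    show "(\<lambda>t. (norm (truncate m (f t) - truncate m (g k t)))\<^sup>2) \<in> borel_measurable ?M" for k
      using cm[OF m fm] cm[OF m gm[of k]] by measurable
    show "AE t in ?M. (\<lambda>k. (norm (truncate m (f t) - truncate m (g k t)))\<^sup>2) \<longlonglongrightarrow> 0"
      using AEN AE_space
    proof eventually_elim
      case (elim t)
      then have "(\<lambda>k. g k t) \<longlonglongrightarrow> f t" using glim[of t] by simp
      moreover have "continuous_on UNIV (truncate m :: 'a \<Rightarrow> 'a)"
        using continuous_on_truncate[OF m continuous_on_id] .
      then have "isCont (truncate m) (f t)" by (simp add: continuous_on_eq_continuous_at)
      ultimately have "(\<lambda>k. truncate m (g k t)) \<longlonglongrightarrow> truncate m (f t)"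
        by (rule isCont_tendsto_compose[rotated])
      then have "(\<lambda>k. (norm (truncate m (f t) - truncate m (g k t)))\<^sup>2) \<longlonglongrightarrow> (norm (truncate m (f t) - truncate m (f t)))\<^sup>2"
        by (intro tendsto_intros)
      then show ?case by simp
    qed
    fix k
    have "(norm (truncate m (f t) - truncate m (g k t)))\<^sup>2 \<le> 4 * m\<^sup>2" for t
    proof -
      have "(norm (truncate m (f t)))\<^sup>2 \<le> m\<^sup>2" "(norm (truncate m (g k t)))\<^sup>2 \<le> m\<^sup>2"
        using m by (auto intro!: power_mono norm_truncate_le)
      then show ?thesis using le[of "truncate m (f t)" "truncate m (g k t)"] by linarith
    qed
    then show "AE t in ?M. norm ((norm (truncate m (f t) - truncate m (g k t)))\<^sup>2) \<le> 4 * m\<^sup>2"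
      by (intro AE_I2) simp
  qed auto
  then have "eventually (\<lambda>k. (LINT t|?M. (norm (truncate m (f t) - truncate m (g k t)))\<^sup>2) < e / 16) sequentially"
    using e by (intro order_tendstoD(2)) auto
  then obtain k where k: "(LINT t|?M. (norm (truncate m (f t) - truncate m (g k t)))\<^sup>2) < e / 16"
    by (auto simp: eventually_sequentially)
  define h where "h t = truncate m (g k t)" for t
  have hc: "continuous_on {a..b} h"
    unfolding h_def using continuous_on_truncate[OF m gc[of k]] continuous_on_subset by blast
  \<comment> \<open>The \<open>+ 1\<close> keeps the quotient meaningful when the interval is degenerate or empty.\<close>
  define d where "d = sqrt (e / (16 * (measure ?M {a..b} + 1)))"
  have d: "d > 0" using e by (simp add: d_def add_nonneg_pos)
  obtain p where p: "polynomial_function p" "\<And>t. t \<in> {a..b} \<Longrightarrow> norm (h t - p t) < d"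
    using Stone_Weierstrass_polynomial_function[OF _ hc d] by auto
  have pc: "continuous_on {a..b} p" by (rule continuous_on_polymonial_function[OF p(1)])
  have hp: "(LINT t|?M. (norm (h t - p t))\<^sup>2) \<le> e / 16"
  proof -
    have "(norm (h t - p t))\<^sup>2 \<le> d\<^sup>2" if "t \<in> {a..b}" for t
      using p(2)[OF that] by (intro power_mono) auto
    then have "(LINT t|?M. (norm (h t - p t))\<^sup>2) \<le> (LINT t|?M. d\<^sup>2)"
      using hc pc by (intro integral_mono continuous_imp_integrable_lebesgue_on continuous_intros) auto
    also have "\<dots> = measure ?M {a..b} * d\<^sup>2" by simp
    also have "\<dots> = e / 16 * (measure ?M {a..b} / (measure ?M {a..b} + 1))"
      using e by (simp add: d_def add_nonneg_nonneg)
    also have "\<dots> \<le> e / 16 * 1" using e by (intro mult_left_mono) (auto simp: divide_simps add_nonneg_pos)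
    finally show ?thesis by simp
  qed
  have f1: "integrable ?M (\<lambda>t. (norm (f t - truncate m (f t)))\<^sup>2)"
  proof (rule Bochner_Integration.integrable_bound)
    show "integrable ?M (\<lambda>t. 2 * (norm (f t))\<^sup>2 + 2 * m\<^sup>2)" using fi by simp
    show "(\<lambda>t. (norm (f t - truncate m (f t)))\<^sup>2) \<in> borel_measurable ?M"
      using cm[OF m fm] by measurable
    have "(norm (f t - truncate m (f t)))\<^sup>2 \<le> 2 * (norm (f t))\<^sup>2 + 2 * m\<^sup>2" for t
      using le[of "f t" "truncate m (f t)"] power_mono[OF norm_truncate_le(1)[OF m, of "f t"] norm_ge_zero, of 2] by linarith
    then show "AE t in ?M. norm ((norm (f t - truncate m (f t)))\<^sup>2) \<le> norm (2 * (norm (f t))\<^sup>2 + 2 * m\<^sup>2)"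
      by (intro AE_I2) simp
  qed
  have f2: "integrable ?M (\<lambda>t. (norm (truncate m (f t) - h t))\<^sup>2)"
  proof (rule Bochner_Integration.integrable_bound)
    show "integrable ?M (\<lambda>t. 4 * m\<^sup>2)" by simp
    show "(\<lambda>t. (norm (truncate m (f t) - h t))\<^sup>2) \<in> borel_measurable ?M"
      unfolding h_def using cm[OF m fm] cm[OF m gm[of k]] by measurable
    have "(norm (truncate m (f t) - h t))\<^sup>2 \<le> 4 * m\<^sup>2" for t
      using le[of "truncate m (f t)" "h t"] power_mono[OF norm_truncate_le(1)[OF m, of "f t"] norm_ge_zero, of 2]
        power_mono[OF norm_truncate_le(1)[OF m, of "g k t"] norm_ge_zero, of 2] unfolding h_def by linarith
    then show "AE t in ?M. norm ((norm (truncate m (f t) - h t))\<^sup>2) \<le> norm (4 * m\<^sup>2)"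
      by (intro AE_I2) simp
  qed
  have f3: "integrable ?M (\<lambda>t. (norm (h t - p t))\<^sup>2)"
    using hc pc by (intro continuous_imp_integrable_lebesgue_on continuous_intros)
  have "(LINT t|?M. (norm (f t - p t))\<^sup>2) \<le>
      (LINT t|?M. 2 * (norm (f t - truncate m (f t)))\<^sup>2 + (4 * (norm (truncate m (f t) - h t))\<^sup>2 + 4 * (norm (h t - p t))\<^sup>2))"
  proof (rule integral_mono_AE')
    show "integrable ?M (\<lambda>t. 2 * (norm (f t - truncate m (f t)))\<^sup>2 + (4 * (norm (truncate m (f t) - h t))\<^sup>2 + 4 * (norm (h t - p t))\<^sup>2))"
      using f1 f2 f3 by simp
    have "(norm (f t - p t))\<^sup>2 \<le> 2 * (norm (f t - truncate m (f t)))\<^sup>2 + (4 * (norm (truncate m (f t) - h t))\<^sup>2 + 4 * (norm (h t - p t))\<^sup>2)" for t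
      using norm_add_power2_le[of "f t - truncate m (f t)" "truncate m (f t) - p t"]
        norm_add_power2_le[of "truncate m (f t) - h t" "h t - p t"] by simp
    then show "AE t in ?M. (norm (f t - p t))\<^sup>2 \<le> 2 * (norm (f t - truncate m (f t)))\<^sup>2 + (4 * (norm (truncate m (f t) - h t))\<^sup>2 + 4 * (norm (h t - p t))\<^sup>2)"
      by (intro AE_I2)
  qed auto
  also have "\<dots> = 2 * (LINT t|?M. (norm (f t - truncate m (f t)))\<^sup>2) + (4 * (LINT t|?M. (norm (truncate m (f t) - h t))\<^sup>2) + 4 * (LINT t|?M. (norm (h t - p t))\<^sup>2))"
    using f1 f2 f3 by simp
  also have "\<dots> < e" using n k hp e unfolding m_def[symmetric] h_def[symmetric] by linarith
  finally show ?thesis using p(1) by blast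
qed


section \<open>Legendre expansions and Parseval remainders\<close>

definition scaled_legendre :: "real \<Rightarrow> nat \<Rightarrow> real \<Rightarrow> complex" where
  "scaled_legendre x n t = of_real (poly (legendre_poly n) (t / x))"

text \<open>
  The factor is the inverse of the squared norm of \<open>scaled_legendre x n\<close> on \<open>{-x..x}\<close>, so these are the
  Fourier coefficients of \<open>f\<close>; they differ from the convention of \<open>FL_coeff\<close> by a factor \<open>x\<close>.
\<close>
definition legendre_coeff :: "real \<Rightarrow> (real \<Rightarrow> complex) \<Rightarrow> nat \<Rightarrow> complex" where
  "legendre_coeff x f n =
     of_real ((2 * real n + 1) / (2 * x)) * (LINT t|lebesgue_on {-x..x}. scaled_legendre x n t * f t)"

definition legendre_sum :: "real \<Rightarrow> (real \<Rightarrow> complex) \<Rightarrow> nat \<Rightarrow> real \<Rightarrow> complex" where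
  "legendre_sum x f N t = (\<Sum>n<N. legendre_coeff x f n * scaled_legendre x n t)"

lemma continuous_on_scaled_legendre [continuous_intros]:
  "x > 0 \<Longrightarrow> continuous_on S (scaled_legendre x n)"
  unfolding scaled_legendre_def by (intro continuous_intros) auto

lemma scaled_legendre_orthogonal:
  assumes "x > 0"
  shows "(LINT t|lebesgue_on {-x..x}. scaled_legendre x m t * scaled_legendre x n t)
     = of_real (if m = n then 2 * x / (2 * real n + 1) else 0)"
proof -
  have "(LINT t|lebesgue_on {-x..x}. scaled_legendre x m t * scaled_legendre x n t)
      = (LINT t|lebesgue_on {-x..x}. complex_of_real (poly (legendre_poly m * legendre_poly n) (t / x)))"
    by (simp add: scaled_legendre_def)
  also have "\<dots> = of_real (x * poly_integral (legendre_poly m * legendre_poly n))"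
    by (simp only: integral_complex_of_real integral_poly_scaled[OF assms])
  finally show ?thesis by (simp add: legendre_orthogonal)
qed

lemma legendre_span_integral:
  assumes x: "x > 0" and A: "A square_integrable_on {-x..x}"
  shows "(LINT t|lebesgue_on {-x..x}. A t * (\<Sum>n<N. d n * scaled_legendre x n t))
       = (\<Sum>n<N. d n * (LINT t|lebesgue_on {-x..x}. A t * scaled_legendre x n t))"
proof -
  have i: "integrable (lebesgue_on {-x..x}) (\<lambda>t. A t * scaled_legendre x n t)" for n
    using x by (intro square_integrable_on_mult_integrable A square_integrable_on_continuous continuous_intros)
  have "(LINT t|lebesgue_on {-x..x}. A t * (\<Sum>n<N. d n * scaled_legendre x n t))
      = (LINT t|lebesgue_on {-x..x}. (\<Sum>n<N. d n * (A t * scaled_legendre x n t)))"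
    by (simp add: sum_distrib_left mult_ac)
  also have "\<dots> = (\<Sum>n<N. (LINT t|lebesgue_on {-x..x}. d n * (A t * scaled_legendre x n t)))"
    using i by (intro Bochner_Integration.integral_sum) auto
  finally show ?thesis by simp
qed

lemma square_integrable_on_legendre_sum:
  assumes "x > 0"
  shows "legendre_sum x f N square_integrable_on {-x..x}"
  unfolding legendre_sum_def
  using assms by (intro square_integrable_on_continuous continuous_intros)

text \<open>
  The coefficients are divided by the squared norms of the basis functions, so \<open>f\<close> and its partial sum have
  the same pairing with each of the first \<open>N\<close> of them.
\<close>
lemma legendre_residual_orthogonal:
  assumes x: "x > 0" and f: "f square_integrable_on {-x..x}" and m: "m < N"
  shows "(LINT t|lebesgue_on {-x..x}. (f t - legendre_sum x f N t) * scaled_legendre x m t) = 0"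
proof -
  let ?M = "lebesgue_on {-x..x}"
  have e: "scaled_legendre x m square_integrable_on {-x..x}"
    using x by (intro square_integrable_on_continuous continuous_intros)
  have "(LINT t|?M. (f t - legendre_sum x f N t) * scaled_legendre x m t)
      = (LINT t|?M. scaled_legendre x m t * f t) - (LINT t|?M. scaled_legendre x m t * legendre_sum x f N t)"
    using square_integrable_on_mult_integrable[OF e f]
      square_integrable_on_mult_integrable[OF e square_integrable_on_legendre_sum[OF x, of f N]]
    by (subst Bochner_Integration.integral_diff[symmetric]) (auto simp: algebra_simps)
  also have "(LINT t|?M. scaled_legendre x m t * legendre_sum x f N t)
      = (\<Sum>n<N. legendre_coeff x f n * of_real (if m = n then 2 * x / (2 * real n + 1) else 0))"
    unfolding legendre_sum_def legendre_span_integral[OF x e] scaled_legendre_orthogonal[OF x] ..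
  also have "\<dots> = legendre_coeff x f m * of_real (2 * x / (2 * real m + 1))"
    using m by (simp add: if_distrib[of of_real] if_distrib[of "\<lambda>u. _ * u"] sum.delta cong: if_cong)
  also have "\<dots> = of_real ((2 * real m + 1) / (2 * x) * (2 * x / (2 * real m + 1))) * (LINT t|?M. scaled_legendre x m t * f t)"
    by (simp only: legendre_coeff_def of_real_mult mult_ac)
  also have "(2 * real m + 1) / (2 * x) * (2 * x / (2 * real m + 1)) = 1"
    using x by (simp add: add_nonneg_eq_0_iff)
  finally show ?thesis by simp
qed

text \<open>
  Pythagoras: the residual \<open>A\<close> is orthogonal to the difference \<open>B\<close> of the partial sum and any other
  element of the span. The basis functions are real, so conjugating \<open>B\<close> only conjugates its coefficients.
\<close>
lemma legendre_sum_best_approximation: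
  assumes x: "x > 0" and f: "f square_integrable_on {-x..x}"
  shows "(LINT t|lebesgue_on {-x..x}. (norm (f t - legendre_sum x f N t))\<^sup>2)
     \<le> (LINT t|lebesgue_on {-x..x}. (norm (f t - (\<Sum>n<N. c n * scaled_legendre x n t)))\<^sup>2)"
proof -
  let ?M = "lebesgue_on {-x..x}"
  define A where "A t = f t - legendre_sum x f N t" for t
  define d where "d n = legendre_coeff x f n - c n" for n
  define B where "B t = (\<Sum>n<N. d n * scaled_legendre x n t)" for t
  have A: "A square_integrable_on {-x..x}"
    unfolding A_def by (intro square_integrable_on_diff f square_integrable_on_legendre_sum x)
  have "continuous_on {-x..x} B"
    unfolding B_def using x by (intro continuous_intros)
  then have Bc: "B square_integrable_on {-x..x}" "(\<lambda>t. cnj (B t)) square_integrable_on {-x..x}"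
    by (auto intro: square_integrable_on_continuous continuous_on_cnj)
  have AB: "f t - (\<Sum>n<N. c n * scaled_legendre x n t) = A t + B t" for t
    by (simp add: A_def B_def d_def legendre_sum_def algebra_simps sum_subtractf)
  have orth: "(LINT t|?M. A t * cnj (B t)) = 0"
  proof -
    have "cnj (B t) = (\<Sum>n<N. cnj (d n) * scaled_legendre x n t)" for t
      by (simp add: B_def scaled_legendre_def)
    then show ?thesis
      using legendre_residual_orthogonal[OF x f] legendre_span_integral[OF x A, of "\<lambda>n. cnj (d n)" N]
      by (simp add: A_def)
  qed
  have i: "integrable ?M (\<lambda>t. (norm (A t))\<^sup>2)" "integrable ?M (\<lambda>t. (norm (B t))\<^sup>2)"
    "integrable ?M (\<lambda>t. A t * cnj (B t))"
    using A Bc square_integrable_on_mult_integrable[OF A Bc(2)] by (auto simp: square_integrable_on_def)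
  define R where "R t = Re (A t * cnj (B t))" for t
  have R: "integrable ?M R" "integral\<^sup>L ?M R = Re (LINT t|?M. A t * cnj (B t))"
    unfolding R_def using integral_Re[OF i(3)] integrable_Re[OF i(3)] by auto
  have "(norm (A t + B t))\<^sup>2 = (norm (A t))\<^sup>2 + (norm (B t))\<^sup>2 + 2 * R t" for t
    by (simp add: cmod_power2 R_def) (simp add: power2_eq_square algebra_simps)
  then have "(LINT t|?M. (norm (A t + B t))\<^sup>2)
      = (LINT t|?M. (norm (A t))\<^sup>2) + (LINT t|?M. (norm (B t))\<^sup>2) + 2 * Re (LINT t|?M. A t * cnj (B t))"
    using i(1,2) R by simp
  also have "\<dots> \<ge> (LINT t|?M. (norm (A t))\<^sup>2)" by (simp add: orth)
  finally show ?thesis unfolding AB by (simp add: A_def)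
qed

text \<open>
  The representation is needed for all large \<open>N\<close>, not just for one, because it is compared with partial
  sums of every large length.
\<close>
lemma real_polynomial_function_legendre:
  assumes x: "x > 0" and r: "real_polynomial_function (r :: real \<Rightarrow> real)"
  shows "\<exists>N0. \<forall>N\<ge>N0. \<exists>c. \<forall>t. r t = (\<Sum>n<N. c n * poly (legendre_poly n) (t / x))"
proof -
  obtain a k where r: "r = (\<lambda>t. \<Sum>i\<le>k. a i * t ^ i)"
    using r unfolding real_polynomial_function_iff_sum by blast
  define q where "q = (\<Sum>i\<le>k. monom (a i * x ^ i) i)"
  have q: "poly q (t / x) = r t" for t
    using x by (simp add: q_def r poly_sum poly_monom power_divide)
  show ?thesis
  proof (intro exI[of _ "Suc (degree q)"] allI impI)
    fix N assume "N \<ge> Suc (degree q)"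
    then obtain c where c: "q = (\<Sum>n<N. smult (c n) (legendre_poly n))"
      using legendre_span[of q N] by auto
    have "r t = (\<Sum>n<N. c n * poly (legendre_poly n) (t / x))" for t
      unfolding q[symmetric] by (subst c) (simp add: poly_sum)
    then show "\<exists>c. \<forall>t. r t = (\<Sum>n<N. c n * poly (legendre_poly n) (t / x))" by blast
  qed
qed

lemma polynomial_function_legendre:
  assumes x: "x > 0" and g: "polynomial_function (g :: real \<Rightarrow> complex)"
  shows "\<exists>N0. \<forall>N\<ge>N0. \<exists>c. \<forall>t. g t = (\<Sum>n<N. c n * scaled_legendre x n t)"
proof -
  have "real_polynomial_function (\<lambda>t. Re (g t))" "real_polynomial_function (\<lambda>t. Im (g t))"
    using g bounded_linear_Re bounded_linear_Im by (auto simp: polynomial_function_def o_def)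
  note re_im = this
  obtain N1 where
    N1: "\<And>N. N \<ge> N1 \<Longrightarrow> \<exists>c. \<forall>t. Re (g t) = (\<Sum>n<N. c n * poly (legendre_poly n) (t / x))"
    using real_polynomial_function_legendre[OF x re_im(1)] by blast
  obtain N2 where
    N2: "\<And>N. N \<ge> N2 \<Longrightarrow> \<exists>c. \<forall>t. Im (g t) = (\<Sum>n<N. c n * poly (legendre_poly n) (t / x))"
    using real_polynomial_function_legendre[OF x re_im(2)] by blast
  show ?thesis
  proof (intro exI[of _ "max N1 N2"] allI impI)
    fix N assume "N \<ge> max N1 N2"
    then obtain c1 c2 where
      "\<And>t. Re (g t) = (\<Sum>n<N. c1 n * poly (legendre_poly n) (t / x))"
      "\<And>t. Im (g t) = (\<Sum>n<N. c2 n * poly (legendre_poly n) (t / x))"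
      using N1[of N] N2[of N] by auto
    then have "g t = (\<Sum>n<N. Complex (c1 n) (c2 n) * scaled_legendre x n t)" for t
      by (intro complex_eqI) (auto simp: scaled_legendre_def)
    then show "\<exists>c. \<forall>t. g t = (\<Sum>n<N. c n * scaled_legendre x n t)"
      by (intro exI[of _ "\<lambda>n. Complex (c1 n) (c2 n)"]) auto
  qed
qed

lemma legendre_sum_tendsto:
  assumes x: "x > 0" and f: "f square_integrable_on {-x..x}"
  shows "(\<lambda>N. LINT t|lebesgue_on {-x..x}. (norm (f t - legendre_sum x f N t))\<^sup>2) \<longlonglongrightarrow> 0"
proof (rule LIMSEQ_I)
  fix e :: real assume "e > 0"
  then obtain g where g: "polynomial_function g"
      "(LINT t|lebesgue_on {-x..x}. (norm (f t - g t))\<^sup>2) < e"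
    using polynomial_dense_square_integrable[OF f] by blast
  obtain N0 where N0: "\<And>N. N \<ge> N0 \<Longrightarrow> \<exists>c. \<forall>t. g t = (\<Sum>n<N. c n * scaled_legendre x n t)"
    using polynomial_function_legendre[OF x g(1)] by blast
  show "\<exists>no. \<forall>N\<ge>no. norm ((LINT t|lebesgue_on {-x..x}. (norm (f t - legendre_sum x f N t))\<^sup>2) - 0) < e"
  proof (intro exI allI impI)
    fix N assume "N \<ge> N0"
    then obtain c where "\<And>t. g t = (\<Sum>n<N. c n * scaled_legendre x n t)" using N0 by blast
    then have "(LINT t|lebesgue_on {-x..x}. (norm (f t - legendre_sum x f N t))\<^sup>2) < e"
      using legendre_sum_best_approximation[OF x f, of N c] g(2) by simp
    then show "norm ((LINT t|lebesgue_on {-x..x}. (norm (f t - legendre_sum x f N t))\<^sup>2) - 0) < e"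
      by simp
  qed
qed

text \<open>
  The remainder of Parseval's series is the integral of the residual of \<open>f\<close> against \<open>g\<close>, which the
  Cauchy-Schwarz inequality bounds by the mean square error of \<open>f\<close> times the size of \<open>g\<close>. The point
  is the order of quantifiers: the null sequence depends on \<open>f\<close> only, and \<open>g\<close> enters only through a bound.
\<close>
lemma legendre_parseval_remainder:
  assumes x: "x > 0" and f: "f square_integrable_on {-x..x}"
  shows "\<exists>\<epsilon>. \<epsilon> \<longlonglongrightarrow> 0 \<and> (\<forall>N. 0 \<le> \<epsilon> N) \<and>
    (\<forall>N g G. continuous_on {-x..x} g \<longrightarrow> (\<forall>t\<in>{-x..x}. norm (g t) \<le> G) \<longrightarrow>
       norm ((LINT t|lebesgue_on {-x..x}. f t * g t)
         - (\<Sum>n<N. legendre_coeff x f n * (LINT t|lebesgue_on {-x..x}. scaled_legendre x n t * g t))) \<le> \<epsilon> N * G)"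
proof -
  let ?M = "lebesgue_on {-x..x}"
  define E where "E N = (LINT t|?M. (norm (f t - legendre_sum x f N t))\<^sup>2)" for N
  define \<epsilon> where "\<epsilon> N = sqrt (E N) * sqrt (2 * x)" for N
  have "\<epsilon> \<longlonglongrightarrow> sqrt 0 * sqrt (2 * x)"
    unfolding \<epsilon>_def E_def by (intro tendsto_intros legendre_sum_tendsto x f)
  then have lim: "\<epsilon> \<longlonglongrightarrow> 0" by simp
  have pos: "0 \<le> \<epsilon> N" for N using x by (simp add: \<epsilon>_def E_def)
  have est: "norm ((LINT t|?M. f t * g t) - (\<Sum>n<N. legendre_coeff x f n * (LINT t|?M. scaled_legendre x n t * g t))) \<le> \<epsilon> N * G"
    if gc: "continuous_on {-x..x} g" and G: "\<forall>t\<in>{-x..x}. norm (g t) \<le> G" for N g G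
  proof -
    have g: "g square_integrable_on {-x..x}" by (rule square_integrable_on_continuous[OF gc])
    have G0: "G \<ge> 0" using G x norm_ge_zero[of "g 0"] by (metis atLeastAtMost_iff neg_le_0_iff_le less_imp_le order_trans)
    let ?A = "\<lambda>t. f t - legendre_sum x f N t"
    have A: "?A square_integrable_on {-x..x}"
      by (intro square_integrable_on_diff f square_integrable_on_legendre_sum x)
    have "(\<Sum>n<N. legendre_coeff x f n * (LINT t|?M. scaled_legendre x n t * g t)) = (LINT t|?M. g t * legendre_sum x f N t)"
      unfolding legendre_sum_def legendre_span_integral[OF x g] by (simp add: mult.commute)
    then have "(LINT t|?M. f t * g t) - (\<Sum>n<N. legendre_coeff x f n * (LINT t|?M. scaled_legendre x n t * g t))
        = (LINT t|?M. ?A t * g t)"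
      using square_integrable_on_mult_integrable[OF f g]
        square_integrable_on_mult_integrable[OF g square_integrable_on_legendre_sum[OF x, of f N]]
      by (simp only:) (subst Bochner_Integration.integral_diff[symmetric], auto simp: algebra_simps)
    also have "norm \<dots> \<le> sqrt (E N) * sqrt (LINT t|?M. (norm (g t))\<^sup>2)"
      unfolding E_def by (rule square_integrable_Cauchy_Schwarz[OF A g])
    also have "\<dots> \<le> sqrt (E N) * (sqrt (2 * x) * G)"
    proof (rule mult_left_mono)
      have "(norm (g t))\<^sup>2 \<le> G\<^sup>2" if "t \<in> {-x..x}" for t
        using G that by (intro power_mono) auto
      then have "(LINT t|?M. (norm (g t))\<^sup>2) \<le> (LINT t|?M. G\<^sup>2)"
        using g x by (intro integral_mono) (auto simp: square_integrable_on_def)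
      also have "\<dots> = 2 * x * G\<^sup>2" using x by (simp add: measure_restrict_space)
      finally have "sqrt (LINT t|?M. (norm (g t))\<^sup>2) \<le> sqrt (2 * x * G\<^sup>2)" by simp
      then show "sqrt (LINT t|?M. (norm (g t))\<^sup>2) \<le> sqrt (2 * x) * G" using G0 by (simp add: real_sqrt_mult)
      show "sqrt (E N) \<ge> 0" by (simp add: E_def)
    qed
    finally show ?thesis by (simp add: \<epsilon>_def mult_ac)
  qed
  show ?thesis using lim pos est by blast
qed

lemma sum_even_odd:
  fixes h :: "nat \<Rightarrow> 'a::comm_monoid_add"
  shows "(\<Sum>m<2 * N. h m) = (\<Sum>n<N. h (2 * n) + h (2 * n + 1))"
  by (induction N) (simp_all add: add.assoc)

text \<open>
  Parseval's series for \<open>g = cos (z t)\<close> and \<open>g = sin (z t)\<close>. Each of them sees the Legendre polynomials of one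
  parity only, and on \<open>{-x..x}\<close> both are bounded by \<open>exp (x \<bar>Im z\<bar>)\<close>, whatever \<open>Re z\<close> is.
\<close>
lemma bessel_series_remainder:
  assumes x: "x > 0" and f: "f square_integrable_on {-x..x}"
  shows "\<exists>\<epsilon>. \<epsilon> \<longlonglongrightarrow> 0 \<and> (\<forall>N. 0 \<le> \<epsilon> N) \<and> (\<forall>N z.
     norm ((LINT t|lebesgue_on {-x..x}. f t * cos (z * of_real t))
       - 2 * (\<Sum>n<N. (-1) ^ n * (of_real x * legendre_coeff x f (2 * n) * spherical_bessel_j (2 * n) (z * of_real x))))
       \<le> \<epsilon> N * exp (x * \<bar>Im z\<bar>) \<and>
     norm ((LINT t|lebesgue_on {-x..x}. f t * sin (z * of_real t))
       - 2 * (\<Sum>n<N. (-1) ^ n * (of_real x * legendre_coeff x f (2 * n + 1) * spherical_bessel_j (2 * n + 1) (z * of_real x))))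
       \<le> \<epsilon> N * exp (x * \<bar>Im z\<bar>))"
proof -
  obtain \<epsilon> where \<epsilon>: "\<epsilon> \<longlonglongrightarrow> 0" "\<And>N. 0 \<le> \<epsilon> N"
    "\<And>N g G. continuous_on {-x..x} g \<Longrightarrow> \<forall>t\<in>{-x..x}. norm (g t) \<le> G \<Longrightarrow>
       norm ((LINT t|lebesgue_on {-x..x}. f t * g t)
         - (\<Sum>n<N. legendre_coeff x f n * (LINT t|lebesgue_on {-x..x}. scaled_legendre x n t * g t))) \<le> \<epsilon> N * G"
    using legendre_parseval_remainder[OF x f] by blast
  have c: "norm (cos (z * of_real t)) \<le> exp (x * \<bar>Im z\<bar>)" "norm (sin (z * of_real t)) \<le> exp (x * \<bar>Im z\<bar>)"
    if t: "t \<in> {-x..x}" for z t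
  proof -
    have "\<bar>Im (z * of_real t)\<bar> \<le> x * \<bar>Im z\<bar>"
      using t by (auto simp: abs_mult mult.commute intro!: mult_right_mono)
    then have e: "exp \<bar>Im (z * of_real t)\<bar> \<le> exp (x * \<bar>Im z\<bar>)" by simp
    show "norm (cos (z * of_real t)) \<le> exp (x * \<bar>Im z\<bar>)"
      using order_trans[OF cmod_cos_le_exp[of 1 "z * of_real t"] e] by simp
    show "norm (sin (z * of_real t)) \<le> exp (x * \<bar>Im z\<bar>)"
      using order_trans[OF cmod_sin_le_exp[of 1 "z * of_real t"] e] by simp
  qed
  have "(\<lambda>N. \<epsilon> (2 * N)) \<longlonglongrightarrow> 0"
    using LIMSEQ_subseq_LIMSEQ[OF \<epsilon>(1), of "\<lambda>N. 2 * N"] by (simp add: strict_mono_def o_def)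
  moreover have "norm ((LINT t|lebesgue_on {-x..x}. f t * cos (z * of_real t))
       - 2 * (\<Sum>n<N. (-1) ^ n * (of_real x * legendre_coeff x f (2 * n) * spherical_bessel_j (2 * n) (z * of_real x))))
       \<le> \<epsilon> (2 * N) * exp (x * \<bar>Im z\<bar>)" for N z
  proof -
    have "(\<Sum>n<2*N. legendre_coeff x f n * (LINT t|lebesgue_on {-x..x}. scaled_legendre x n t * cos (z * of_real t)))
       = 2 * (\<Sum>n<N. (-1) ^ n * (of_real x * legendre_coeff x f (2 * n) * spherical_bessel_j (2 * n) (z * of_real x)))"
      unfolding sum_even_odd scaled_legendre_def legendre_cos_integral[OF x] sum_distrib_left
      by (intro sum.cong) (auto simp: mult_ac)
    moreover have "continuous_on {-x..x} (\<lambda>t. cos (z * complex_of_real t))"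
      by (intro continuous_intros)
    ultimately show ?thesis using \<epsilon>(3)[of "\<lambda>t. cos (z * of_real t)" "exp (x * \<bar>Im z\<bar>)" "2 * N"] c(1) by simp
  qed
  moreover have "norm ((LINT t|lebesgue_on {-x..x}. f t * sin (z * of_real t))
       - 2 * (\<Sum>n<N. (-1) ^ n * (of_real x * legendre_coeff x f (2 * n + 1) * spherical_bessel_j (2 * n + 1) (z * of_real x))))
       \<le> \<epsilon> (2 * N) * exp (x * \<bar>Im z\<bar>)" for N z
  proof -
    have "(\<Sum>n<2*N. legendre_coeff x f n * (LINT t|lebesgue_on {-x..x}. scaled_legendre x n t * sin (z * of_real t)))
       = 2 * (\<Sum>n<N. (-1) ^ n * (of_real x * legendre_coeff x f (2 * n + 1) * spherical_bessel_j (2 * n + 1) (z * of_real x)))"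
      unfolding sum_even_odd scaled_legendre_def legendre_sin_integral[OF x] sum_distrib_left
      by (intro sum.cong) (auto simp: mult_ac)
    moreover have "continuous_on {-x..x} (\<lambda>t. sin (z * complex_of_real t))"
      by (intro continuous_intros)
    ultimately show ?thesis using \<epsilon>(3)[of "\<lambda>t. sin (z * of_real t)" "exp (x * \<bar>Im z\<bar>)" "2 * N"] c(2) by simp
  qed
  ultimately show ?thesis using \<epsilon>(2) by (intro exI[of _ "\<lambda>N. \<epsilon> (2 * N)"]) blast
qed


section \<open>The Dirac equation\<close>

definition rotation :: "complex \<Rightarrow> complex \<Rightarrow> complex^2^2" where
  "rotation c s = vector [vector [c, - s], vector [s, c]]"

lemma vec2_eq_iff: "(v :: 'a^2) = w \<longleftrightarrow> v $ 1 = w $ 1 \<and> v $ 2 = w $ 2"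
  by (simp add: vec_eq_iff forall_2)

lemma mat2_mult_component: "((A :: 'a::semiring_1^2^2) ** B) $ i $ j = A $ i $ 1 * B $ 1 $ j + A $ i $ 2 * B $ 2 $ j"
  by (simp add: matrix_matrix_mult_def sum_2)

lemma mat2_mult_scaleR: "(A :: complex^2^2) ** (r *\<^sub>R (B :: complex^2^2)) = r *\<^sub>R (A ** B)"
  by (simp add: vec2_eq_iff mat2_mult_component scaleR_right_distrib)

lemma mat2_vec_component: "((A :: 'a::semiring_1^2^2) *v v) $ i = A $ i $ 1 * v $ 1 + A $ i $ 2 * v $ 2"
  by (simp add: matrix_vector_mult_def sum_2)

lemma mat2_component [simp]: "(mat a :: 'a::zero^2^2) $ 1 $ 1 = a" "(mat a :: 'a^2^2) $ 1 $ 2 = 0"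
  "(mat a :: 'a^2^2) $ 2 $ 1 = 0" "(mat a :: 'a^2^2) $ 2 $ 2 = a"
  by (simp_all add: mat_def)

text \<open>
  \<open>- dirac_B\<close> squares to \<open>- mat 1\<close>, so its exponential is given by Euler's formula.
\<close>
lemma matrix_exp_dirac_B: "matrix_exp (- (mat w ** dirac_B)) = rotation (cos w) (sin w)"
proof -
  let ?A = "- (mat w ** dirac_B)"
  let ?c = "\<lambda>k. cos_coeff k *\<^sub>R w ^ k" and ?s = "\<lambda>k. sin_coeff k *\<^sub>R w ^ k"
  have A: "?A = rotation 0 w"
    by (simp add: vec2_eq_iff mat2_mult_component rotation_def dirac_B_def)
  have exp_term: "(1 / fact k) *\<^sub>R (((**) ?A ^^ k) (mat 1)) = rotation (?c k) (?s k)" for k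
  proof (induction k)
    case 0
    show ?case by (simp add: vec2_eq_iff rotation_def)
  next
    case (Suc k)
    have "(1 / fact (Suc k)) *\<^sub>R (((**) ?A ^^ Suc k) (mat 1))
        = (1 / real (Suc k)) *\<^sub>R (?A ** ((1 / fact k) *\<^sub>R (((**) ?A ^^ k) (mat 1))))"
      by (simp add: mat2_mult_scaleR)
    also have "\<dots> = rotation (?c (Suc k)) (?s (Suc k))"
      unfolding Suc unfolding A cos_coeff_Suc sin_coeff_Suc
      by (simp add: vec2_eq_iff mat2_mult_component rotation_def)
    finally show ?case .
  qed
  have c: "(\<lambda>n. \<Sum>k<n. ?c k) \<longlonglongrightarrow> cos w" and s: "(\<lambda>n. \<Sum>k<n. ?s k) \<longlonglongrightarrow> sin w"
    using cos_converges[of w] sin_converges[of w] by (simp_all add: sums_def)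
  have "(\<lambda>k. rotation (?c k) (?s k)) sums rotation (cos w) (sin w)"
    unfolding sums_def
  proof (intro vec_tendstoI)
    fix i j :: 2
    have "(\<Sum>k<n. rotation (?c k) (?s k)) $ i $ j = rotation (\<Sum>k<n. ?c k) (\<Sum>k<n. ?s k) $ i $ j" for n
      using exhaust_2[of i] exhaust_2[of j] by (auto simp: rotation_def sum_negf)
    moreover have "(\<lambda>n. rotation (\<Sum>k<n. ?c k) (\<Sum>k<n. ?s k) $ i $ j) \<longlonglongrightarrow> rotation (cos w) (sin w) $ i $ j"
      using exhaust_2[of i] exhaust_2[of j] tendsto_minus[OF s] c s by (auto simp: rotation_def)
    ultimately show "(\<lambda>n. (\<Sum>k<n. rotation (?c k) (?s k)) $ i $ j) \<longlonglongrightarrow> rotation (cos w) (sin w) $ i $ j"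
      by simp
  qed
  then show ?thesis unfolding matrix_exp_def exp_term by (simp add: sums_iff)
qed

lemma
  fixes f :: "'a \<Rightarrow> 'b::euclidean_space^'n"
  assumes "\<And>i. integrable M (\<lambda>x. f x $ i)"
  shows integrable_vec: "integrable M f"
    and integral_vec_component: "(integral\<^sup>L M f) $ i = (LINT x|M. f x $ i)"
proof -
  have lin: "bounded_linear (axis i :: 'b \<Rightarrow> 'b^'n)" for i
    by (simp add: linear_conv_bounded_linear[symmetric] linear_iff axis_def vec_eq_iff)
  have "f = (\<lambda>x. \<Sum>i\<in>UNIV. axis i (f x $ i))"
    by (simp add: fun_eq_iff vec_eq_iff axis_def if_distrib[where f = "\<lambda>x. x $ _"] cong: if_cong)
  moreover have "integrable M (\<lambda>x. \<Sum>i\<in>UNIV. axis i (f x $ i))"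
    by (intro Bochner_Integration.integrable_sum integrable_bounded_linear[OF lin] assms)
  ultimately show f: "integrable M f" by simp
  show "(integral\<^sup>L M f) $ i = (LINT x|M. f x $ i)"
    using integral_bounded_linear[OF bounded_linear_vec_nth f, of i] by simp
qed

lemma square_integrable_on_component:
  fixes f :: "real \<Rightarrow> 'b::euclidean_space^'n"
  assumes "f square_integrable_on S"
  shows "(\<lambda>t. f t $ i) square_integrable_on S"
proof -
  have m: "f \<in> borel_measurable (lebesgue_on S)" and i: "integrable (lebesgue_on S) (\<lambda>t. (norm (f t))\<^sup>2)"
    using assms by (auto simp: square_integrable_on_def)
  have m': "(\<lambda>t. f t $ i) \<in> borel_measurable (lebesgue_on S)"
    using measurable_compose[OF m borel_measurable_continuous_onI[OF linear_continuous_on[OF bounded_linear_vec_nth]]]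
    by simp
  have "integrable (lebesgue_on S) (\<lambda>t. (norm (f t $ i))\<^sup>2)"
  proof (rule Bochner_Integration.integrable_bound[OF i])
    show "(\<lambda>t. (norm (f t $ i))\<^sup>2) \<in> borel_measurable (lebesgue_on S)" using m' by measurable
    show "AE t in lebesgue_on S. norm ((norm (f t $ i))\<^sup>2) \<le> norm ((norm (f t))\<^sup>2)"
      by (intro AE_I2) (simp add: power_mono Finite_Cartesian_Product.norm_nth_le)
  qed
  then show ?thesis using m' by (simp add: square_integrable_on_def)
qed

lemma FL_coeff_component:
  assumes x: "x > 0" and K: "K x square_integrable_on {-x..x}"
  shows "FL_coeff K n x $ i $ j = of_real x * legendre_coeff x (\<lambda>t. K x t $ i $ j) n"
proof -
  have e: "scaled_legendre x n square_integrable_on {-x..x}"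
    using x by (intro square_integrable_on_continuous continuous_intros)
  have comp: "(\<lambda>t. K x t $ i $ j) square_integrable_on {-x..x}" for i j
    by (intro square_integrable_on_component K)
  have eq: "(poly (legendre_poly n) (t / x) *\<^sub>R K x t) $ i $ j = scaled_legendre x n t * K x t $ i $ j" for t i j
    unfolding vector_scaleR_component scaled_legendre_def by (rule scaleR_conv_of_real)
  have int: "integrable (lebesgue_on {-x..x}) (\<lambda>t. (poly (legendre_poly n) (t / x) *\<^sub>R K x t) $ i $ j)" for i j
    unfolding eq by (intro square_integrable_on_mult_integrable e comp)
  have "(LINT t|lebesgue_on {-x..x}. poly (legendre_poly n) (t / x) *\<^sub>R K x t) $ i $ j
      = (LINT t|lebesgue_on {-x..x}. scaled_legendre x n t * K x t $ i $ j)"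
    by (subst integral_vec_component, rule integrable_vec, rule int,
        subst integral_vec_component, rule int) (simp only: eq)
  then show ?thesis
    using x unfolding FL_coeff_def legendre_coeff_def if_not_P[OF less_imp_neq[OF x, symmetric]]
    by (simp only: vector_scaleR_component) (simp add: scaleR_conv_of_real)
qed

lemma norm_vec2_le: "norm (v :: 'a::real_normed_vector^2) \<le> norm (v $ 1) + norm (v $ 2)"
  unfolding norm_vec_def using L2_set_le_sum[of UNIV "\<lambda>i. norm (v $ i)"] by (simp add: sum_2)

text \<open>
  The difference \<open>W\<close> of the two sides solves the Dirac equation and vanishes at \<open>0\<close>. As \<open>dirac_B\<close> is
  invertible, the equation bounds \<open>norm W'\<close> by an integrable multiple of \<open>norm W\<close>, and \<open>W\<close> is zero by
  Gronwall's argument.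
\<close>
lemma dirac_solution_unique:
  assumes p: "p square_integrable_on {0..1}" and q: "q square_integrable_on {0..1}"
    and U: "dirac_matrix_solution p q z U" and Y: "dirac_solution p q z Y"
    and init: "Y 0 = U 0 *v c" and x: "x \<in> {0..1}"
  shows "Y x = U x *v c"
proof -
  define W where "W x = Y x - U x *v c" for x
  have bl: "bounded_linear (\<lambda>A :: complex^2^2. A *v c)"
    by (simp add: linear_conv_bounded_linear[symmetric] linear_iff vec2_eq_iff mat2_vec_component
        algebra_simps)
  define k where "k x = 2 * (norm z + \<bar>p x\<bar> + \<bar>q x\<bar>)" for x
  have int: "integrable (lebesgue_on {0..1}) p" "integrable (lebesgue_on {0..1}) q"
    using p q finite_measure.square_integrable_imp_integrable[OF finite_measure_lebesgue_on]
    by (auto simp: square_integrable_on_def)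
  have "integrable (lebesgue_on {0..1}) k"
    unfolding k_def using int finite_measure.integrable_const[OF finite_measure_lebesgue_on, of "{0..1}"] by auto
  then have k: "k integrable_on {0..1}" by (rule integrable_on_lebesgue_on) auto
  have "W x = 0"
  proof (rule linear_differential_inequality_unique[OF _ _ k _ _ x])
    show "absolutely_continuous_on {0..1} W"
      unfolding W_def using Y U
      by (intro absolutely_continuous_on_diff_linear[OF _ _ bl])
         (auto simp: dirac_solution_def dirac_matrix_solution_def)
    show "W 0 = 0" by (simp add: W_def init)
    show "0 \<le> k x" for x by (simp add: k_def)
    have "AE x in lebesgue_on {0..1}. \<exists>Y'. (Y has_vector_derivative Y') (at x within {0..1}) \<and>
        dirac_B *v Y' + dirac_Q p q x *v Y x = z *s Y x"
      "AE x in lebesgue_on {0..1}. \<exists>U'. (U has_vector_derivative U') (at x within {0..1}) \<and>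
        dirac_B ** U' + dirac_Q p q x ** U x = mat z ** U x"
      using Y U by (auto simp: dirac_solution_def dirac_matrix_solution_def)
    then show "AE x in lebesgue_on {0..1}. \<exists>W'. (W has_vector_derivative W') (at x within {0..1}) \<and>
        norm W' \<le> k x * norm (W x)"
    proof eventually_elim
      case (elim x)
      then obtain Y' U' where Y': "(Y has_vector_derivative Y') (at x within {0..1})"
          "dirac_B *v Y' + dirac_Q p q x *v Y x = z *s Y x"
        and U': "(U has_vector_derivative U') (at x within {0..1})"
          "dirac_B ** U' + dirac_Q p q x ** U x = mat z ** U x"
        by blast
      define W' where "W' = Y' - U' *v c"
      have der: "(W has_vector_derivative W') (at x within {0..1})"
        unfolding W_def W'_def
        by (intro has_vector_derivative_diff Y'(1) bounded_linear.has_vector_derivative[OF bl U'(1)])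
      have "dirac_B *v (U' *v c) + dirac_Q p q x *v (U x *v c) = z *s (U x *v c)"
        using arg_cong[OF U'(2), of "\<lambda>A. A *v c"]
        by (simp add: matrix_vector_mult_add_rdistrib matrix_vector_mul_assoc)
           (simp add: vec2_eq_iff mat2_vec_component mat2_mult_component algebra_simps)
      then have eq: "dirac_B *v W' + dirac_Q p q x *v W x = z *s W x"
        using Y'(2) by (simp add: W_def W'_def matrix_vector_mult_diff_distrib vector_ssub_ldistrib
            flip: add_diff_add)
      let ?p = "complex_of_real (p x)" and ?q = "complex_of_real (q x)"
      have W2: "W' $ 2 = (z - ?p) * W x $ 1 - ?q * W x $ 2"
        and W1: "W' $ 1 = ?q * W x $ 1 - (z + ?p) * W x $ 2"
        using eq unfolding vec2_eq_iff
        by (simp_all add: mat2_vec_component dirac_B_def dirac_Q_def algebra_simps)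
      have n: "norm (W x $ i) \<le> norm (W x)" for i by (rule Finite_Cartesian_Product.norm_nth_le)
      have b: "norm (a * W x $ 1 - b * W x $ 2) \<le> (norm a + norm b) * norm (W x)" for a b
        using norm_triangle_ineq4[of "a * W x $ 1" "b * W x $ 2"]
          mult_left_mono[OF n[of 1], of "norm a"] mult_left_mono[OF n[of 2], of "norm b"]
        by (simp add: norm_mult algebra_simps)
      have "norm (z - ?p) \<le> norm z + \<bar>p x\<bar>" "norm (z + ?p) \<le> norm z + \<bar>p x\<bar>"
        using norm_triangle_ineq4[of z ?p] norm_triangle_ineq[of z ?p] by simp_all
      then have "norm (W' $ 1) \<le> (norm z + \<bar>p x\<bar> + \<bar>q x\<bar>) * norm (W x)"
          "norm (W' $ 2) \<le> (norm z + \<bar>p x\<bar> + \<bar>q x\<bar>) * norm (W x)"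
        unfolding W1 W2 by (auto intro!: order_trans[OF b] mult_right_mono)
      then have "norm W' \<le> k x * norm (W x)"
        using norm_vec2_le[of W'] by (simp add: k_def algebra_simps)
      with der show ?case by blast
    qed
  qed
  then show ?thesis by (simp add: W_def)
qed


section \<open>Neumann series of Bessel functions\<close>

text \<open>
  A fixed exponential as the factor depending on \<open>Im z\<close> makes the estimate stable under linear combinations,
  which is how the third solution is reduced to the first two.
\<close>
definition exp_type_remainder ::
    "real \<Rightarrow> (complex \<Rightarrow> complex^2) \<Rightarrow> (nat \<Rightarrow> complex \<Rightarrow> complex^2) \<Rightarrow> bool" where
  "exp_type_remainder x Y Ys \<longleftrightarrow> (\<exists>\<epsilon> :: nat \<Rightarrow> real. \<epsilon> \<longlonglongrightarrow> 0 \<and> (\<forall>N. 0 \<le> \<epsilon> N) \<and>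
     (\<forall>N z. norm (Y z - Ys N z) \<le> \<epsilon> N * exp (x * \<bar>Im z\<bar>)))"

lemma exp_type_remainder_Re_independent:
  assumes "exp_type_remainder x Y Ys" "x \<ge> 0"
  shows "Re_independent_remainder_estimate Y Ys"
proof -
  have "mono (\<lambda>y. exp (x * y))" using assms(2) by (auto simp: mono_def mult_left_mono)
  then show ?thesis
    using assms(1) unfolding exp_type_remainder_def Re_independent_remainder_estimate_def by blast
qed

lemma exp_type_remainder_uniform_limit:
  assumes "exp_type_remainder x Y Ys" "x \<ge> 0" "bounded A"
  shows "uniform_limit A Ys Y sequentially"
proof -
  obtain \<epsilon> where \<epsilon>: "\<epsilon> \<longlonglongrightarrow> 0" "\<And>N. 0 \<le> \<epsilon> N"
    "\<And>N z. norm (Y z - Ys N z) \<le> \<epsilon> N * exp (x * \<bar>Im z\<bar>)"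
    using assms(1) unfolding exp_type_remainder_def by blast
  obtain r where r: "\<And>z. z \<in> A \<Longrightarrow> norm z \<le> r" using assms(3) unfolding bounded_iff by blast
  have b: "dist (Ys N z) (Y z) \<le> \<epsilon> N * exp (x * r)" if "z \<in> A" for N z
  proof -
    have "\<bar>Im z\<bar> \<le> r" using r[OF that] abs_Im_le_cmod[of z] by linarith
    then have "\<epsilon> N * exp (x * \<bar>Im z\<bar>) \<le> \<epsilon> N * exp (x * r)"
      using \<epsilon>(2) assms(2) by (intro mult_left_mono) (auto intro: mult_left_mono)
    then show ?thesis using \<epsilon>(3)[where N = N and z = z] by (simp add: dist_norm norm_minus_commute)
  qed
  show ?thesis
  proof (rule uniform_limitI)
    fix e :: real assume "e > 0"
    moreover have "(\<lambda>N. \<epsilon> N * exp (x * r)) \<longlonglongrightarrow> 0" using tendsto_mult_right[OF \<epsilon>(1), of "exp (x * r)"] by simp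
    ultimately have "\<forall>\<^sub>F N in sequentially. \<epsilon> N * exp (x * r) < e" by (rule order_tendstoD(2)[rotated])
    then show "\<forall>\<^sub>F N in sequentially. \<forall>z\<in>A. dist (Ys N z) (Y z) < e"
      by eventually_elim (use b in \<open>auto intro: le_less_trans\<close>)
  qed
qed

lemma vector_scalar_mult_complex_of_real: "complex_of_real a *s v = a *\<^sub>R v"
  unfolding vec_eq_iff vector_scaleR_component vector_smult_component by (simp add: scaleR_conv_of_real)

text \<open>
  Summability is not known beforehand; it is read off from the convergence of the partial sums.
\<close>
lemma exp_type_remainder_series:
  assumes "exp_type_remainder x Y (\<lambda>N z. I z + 2 *s (\<Sum>n<N. T z n))" "x \<ge> 0"
  shows "summable (T z)" "Y z = I z + 2 *s (\<Sum>n. T z n)"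
proof -
  have two: "2 *s v = 2 *\<^sub>R v" for v :: "complex^2"
    using vector_scalar_mult_complex_of_real[of 2 v] by simp
  have "(\<lambda>N. I z + 2 *s (\<Sum>n<N. T z n)) \<longlonglongrightarrow> Y z"
    using tendsto_uniform_limitI[OF exp_type_remainder_uniform_limit[OF assms, of "{z}"]] by simp
  then have "(\<lambda>N. (1/2) *\<^sub>R ((I z + 2 *s (\<Sum>n<N. T z n)) - I z)) \<longlonglongrightarrow> (1/2) *\<^sub>R (Y z - I z)"
    by (intro tendsto_intros)
  then have "T z sums ((1/2) *\<^sub>R (Y z - I z))" by (simp add: sums_def two)
  then show "summable (T z)" "Y z = I z + 2 *s (\<Sum>n. T z n)" by (simp_all add: sums_iff two)
qed

lemma norm_vector_scalar_mult: "norm (a *s (v :: complex^'n)) = norm a * norm v"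
  by (simp add: norm_vec_def norm_mult L2_set_right_distrib)

lemma exp_type_remainder_combine:
  assumes "exp_type_remainder x Y A" "exp_type_remainder x Z B"
  shows "exp_type_remainder x (\<lambda>z. a *s Y z + b *s Z z) (\<lambda>N z. a *s A N z + b *s B N z)"
proof -
  obtain \<epsilon> where \<epsilon>: "\<epsilon> \<longlonglongrightarrow> 0" "\<And>N. 0 \<le> \<epsilon> N"
    "\<And>N z. norm (Y z - A N z) \<le> \<epsilon> N * exp (x * \<bar>Im z\<bar>)"
    using assms(1) unfolding exp_type_remainder_def by blast
  obtain \<eta> where \<eta>: "\<eta> \<longlonglongrightarrow> 0" "\<And>N. 0 \<le> \<eta> N"
    "\<And>N z. norm (Z z - B N z) \<le> \<eta> N * exp (x * \<bar>Im z\<bar>)"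
    using assms(2) unfolding exp_type_remainder_def by blast
  have "(\<lambda>N. norm a * \<epsilon> N + norm b * \<eta> N) \<longlonglongrightarrow> norm a * 0 + norm b * 0"
    by (intro tendsto_intros \<epsilon> \<eta>)
  moreover have "norm ((a *s Y z + b *s Z z) - (a *s A N z + b *s B N z))
      \<le> (norm a * \<epsilon> N + norm b * \<eta> N) * exp (x * \<bar>Im z\<bar>)" for N z
  proof -
    have "(a *s Y z + b *s Z z) - (a *s A N z + b *s B N z) = a *s (Y z - A N z) + b *s (Z z - B N z)"
      by (simp add: vec_eq_iff algebra_simps)
    then have "norm ((a *s Y z + b *s Z z) - (a *s A N z + b *s B N z))
        \<le> norm a * norm (Y z - A N z) + norm b * norm (Z z - B N z)"
      using norm_triangle_ineq by (metis norm_vector_scalar_mult)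
    also have "\<dots> \<le> norm a * (\<epsilon> N * exp (x * \<bar>Im z\<bar>)) + norm b * (\<eta> N * exp (x * \<bar>Im z\<bar>))"
      by (intro add_mono mult_left_mono \<epsilon> \<eta>) auto
    finally show ?thesis by (simp add: algebra_simps)
  qed
  ultimately show ?thesis
    unfolding exp_type_remainder_def
    using \<epsilon>(2) \<eta>(2) by (intro exI[of _ "\<lambda>N. norm a * \<epsilon> N + norm b * \<eta> N"]) auto
qed

lemma FL_coeff_zero [simp]: "FL_coeff K n 0 = 0"
  by (simp add: FL_coeff_def)

lemma rotation_integral_component:
  fixes z :: complex and K :: "real \<Rightarrow> complex^2^2"
  assumes x: "x > 0" and K: "K square_integrable_on {-x..x}"
  defines "I \<equiv> (LINT t|lebesgue_on {-x..x}. K t ** rotation (cos (z * of_real t)) (sin (z * of_real t)))"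
  shows "I $ i $ 1 = (LINT t|lebesgue_on {-x..x}. K t $ i $ 1 * cos (z * of_real t))
                   + (LINT t|lebesgue_on {-x..x}. K t $ i $ 2 * sin (z * of_real t))"
    and "I $ i $ 2 = (LINT t|lebesgue_on {-x..x}. K t $ i $ 2 * cos (z * of_real t))
                   - (LINT t|lebesgue_on {-x..x}. K t $ i $ 1 * sin (z * of_real t))"
proof -
  let ?M = "lebesgue_on {-x..x}"
  let ?F = "\<lambda>t. K t ** rotation (cos (z * of_real t)) (sin (z * of_real t))"
  have k: "(\<lambda>t. K t $ i $ j) square_integrable_on {-x..x}" for i j
    by (intro square_integrable_on_component K)
  have c: "integrable ?M (\<lambda>t. K t $ i $ j * cos (z * of_real t))" for i j
    by (intro square_integrable_on_mult_integrable k square_integrable_on_continuous continuous_intros)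
  have s: "integrable ?M (\<lambda>t. K t $ i $ j * sin (z * of_real t))" for i j
    by (intro square_integrable_on_mult_integrable k square_integrable_on_continuous continuous_intros)
  have F: "?F t $ i $ 1 = K t $ i $ 1 * cos (z * of_real t) + K t $ i $ 2 * sin (z * of_real t)"
    "?F t $ i $ 2 = K t $ i $ 2 * cos (z * of_real t) - K t $ i $ 1 * sin (z * of_real t)" for t i
    by (simp_all add: mat2_mult_component rotation_def)
  have int: "integrable ?M (\<lambda>t. ?F t $ i $ j)" for i j
    using exhaust_2[of j] c[of i] s[of i] F by auto
  have "I $ i $ j = (LINT t|?M. ?F t $ i $ j)" for j
    unfolding I_def by (subst integral_vec_component, rule integrable_vec, rule int,
        subst integral_vec_component, rule int) simp
  then show "I $ i $ 1 = (LINT t|?M. K t $ i $ 1 * cos (z * of_real t)) + (LINT t|?M. K t $ i $ 2 * sin (z * of_real t))"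
    "I $ i $ 2 = (LINT t|?M. K t $ i $ 2 * cos (z * of_real t)) - (LINT t|?M. K t $ i $ 1 * sin (z * of_real t))"
    using c s F by simp_all
qed

lemma
  assumes x: "x > 0" and K: "K x square_integrable_on {-x..x}"
    and U: "\<And>z. U z = matrix_exp (- (mat (z * of_real x) ** dirac_B))
        + (LINT t|lebesgue_on {-x..x}. K x t ** matrix_exp (- (mat (z * of_real t) ** dirac_B)))"
  shows nsbf_remainder_C: "exp_type_remainder x (\<lambda>z. U z *v vector [1, 0])
        (\<lambda>N z. nsbf_init_C z x + 2 *s (\<Sum>n<N. nsbf_term_C K z x n))"
    and nsbf_remainder_S: "exp_type_remainder x (\<lambda>z. U z *v vector [0, 1])
        (\<lambda>N z. nsbf_init_S z x + 2 *s (\<Sum>n<N. nsbf_term_S K z x n))"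
proof -
  let ?M = "lebesgue_on {-x..x}"
  define Ic where "Ic i j z = (LINT t|?M. K x t $ i $ j * cos (z * of_real t))" for i j z
  define Is where "Is i j z = (LINT t|?M. K x t $ i $ j * sin (z * of_real t))" for i j z
  define Sc where "Sc i j N z = (\<Sum>n<N. (-1) ^ n * (FL_coeff K (2 * n) x $ i $ j * spherical_bessel_j (2 * n) (z * of_real x)))" for i j N z
  define Ss where "Ss i j N z = (\<Sum>n<N. (-1) ^ n * (FL_coeff K (2 * n + 1) x $ i $ j * spherical_bessel_j (2 * n + 1) (z * of_real x)))" for i j N z
  have "\<exists>\<epsilon> :: nat \<Rightarrow> real. \<epsilon> \<longlonglongrightarrow> 0 \<and> (\<forall>N. 0 \<le> \<epsilon> N) \<and> (\<forall>N z.
     norm (Ic i j z - 2 * Sc i j N z) \<le> \<epsilon> N * exp (x * \<bar>Im z\<bar>) \<and>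
     norm (Is i j z - 2 * Ss i j N z) \<le> \<epsilon> N * exp (x * \<bar>Im z\<bar>))" for i j
    unfolding Ic_def Is_def Sc_def Ss_def FL_coeff_component[where K = K, OF x K]
    by (intro bessel_series_remainder x square_integrable_on_component K)
  then obtain e where e: "\<And>i j. e i j \<longlonglongrightarrow> (0::real)" "\<And>i j N. 0 \<le> e i j N"
      "\<And>i j N z. norm (Ic i j z - 2 * Sc i j N z) \<le> e i j N * exp (x * \<bar>Im z\<bar>)"
      "\<And>i j N z. norm (Is i j z - 2 * Ss i j N z) \<le> e i j N * exp (x * \<bar>Im z\<bar>)"
    by metis
  define \<epsilon> where "\<epsilon> N = e 1 1 N + e 1 2 N + (e 2 1 N + e 2 2 N)" for N
  have "\<epsilon> \<longlonglongrightarrow> 0 + 0 + (0 + 0)" unfolding \<epsilon>_def by (intro tendsto_intros e)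
  then have lim: "\<epsilon> \<longlonglongrightarrow> 0" by simp
  have pos: "0 \<le> \<epsilon> N" for N unfolding \<epsilon>_def by (intro add_nonneg_nonneg e)
  have U1: "U z $ i $ 1 = rotation (cos (z * of_real x)) (sin (z * of_real x)) $ i $ 1 + (Ic i 1 z + Is i 2 z)"
    and U2: "U z $ i $ 2 = rotation (cos (z * of_real x)) (sin (z * of_real x)) $ i $ 2 + (Ic i 2 z - Is i 1 z)" for i z
    unfolding U matrix_exp_dirac_B Ic_def Is_def
    by (simp_all add: rotation_integral_component[OF x K])
  \<comment> \<open>Entry by entry, the remainder of the column is a sum of remainders of scalar Bessel series.\<close>
  have C: "(U z *v vector [1, 0] - (nsbf_init_C z x + 2 *s (\<Sum>n<N. nsbf_term_C K z x n))) $ i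
      = (Ic i 1 z - 2 * Sc i 1 N z) + (Is i 2 z - 2 * Ss i 2 N z)" for i N z
  proof -
    have sum: "(\<Sum>n<N. nsbf_term_C K z x n) $ i = Sc i 1 N z + Ss i 2 N z"
      using exhaust_2[of i] unfolding Sc_def Ss_def sum.distrib[symmetric] sum_component
      by (auto intro!: sum.cong simp: nsbf_term_C_def FL_coeff_C_def mat2_vec_component algebra_simps)
    show ?thesis
      unfolding vector_minus_component vector_add_component vector_smult_component sum
      using exhaust_2[of i] by (auto simp: mat2_vec_component U1 rotation_def nsbf_init_C_def algebra_simps)
  qed
  have S: "(U z *v vector [0, 1] - (nsbf_init_S z x + 2 *s (\<Sum>n<N. nsbf_term_S K z x n))) $ i
      = (Ic i 2 z - 2 * Sc i 2 N z) - (Is i 1 z - 2 * Ss i 1 N z)" for i N z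
  proof -
    have sum: "(\<Sum>n<N. nsbf_term_S K z x n) $ i = Sc i 2 N z - Ss i 1 N z"
      using exhaust_2[of i] unfolding Sc_def Ss_def sum_subtractf[symmetric] sum_component
      by (auto intro!: sum.cong simp: nsbf_term_S_def FL_coeff_S_def mat2_vec_component algebra_simps)
    show ?thesis
      unfolding vector_minus_component vector_add_component vector_smult_component sum
      using exhaust_2[of i] by (auto simp: mat2_vec_component U2 rotation_def nsbf_init_S_def algebra_simps)
  qed
  have bC: "norm (U z *v vector [1, 0] - (nsbf_init_C z x + 2 *s (\<Sum>n<N. nsbf_term_C K z x n)))
      \<le> \<epsilon> N * exp (x * \<bar>Im z\<bar>)" for N z
  proof -
    have "norm ((Ic i 1 z - 2 * Sc i 1 N z) + (Is i 2 z - 2 * Ss i 2 N z)) \<le> (e i 1 N + e i 2 N) * exp (x * \<bar>Im z\<bar>)" for i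
      unfolding distrib_right by (intro order_trans[OF norm_triangle_ineq] add_mono e)
    then show ?thesis
      unfolding \<epsilon>_def distrib_right[of "e 1 1 N + e 1 2 N"]
      by (intro order_trans[OF norm_vec2_le] add_mono) (simp_all only: C)
  qed
  have bS: "norm (U z *v vector [0, 1] - (nsbf_init_S z x + 2 *s (\<Sum>n<N. nsbf_term_S K z x n)))
      \<le> \<epsilon> N * exp (x * \<bar>Im z\<bar>)" for N z
  proof -
    have "norm ((Ic i 2 z - 2 * Sc i 2 N z) - (Is i 1 z - 2 * Ss i 1 N z)) \<le> (e i 1 N + e i 2 N) * exp (x * \<bar>Im z\<bar>)" for i
      unfolding distrib_right add.commute[of "e i 1 N * _"]
      by (intro order_trans[OF norm_triangle_ineq4] add_mono e)
    then show ?thesis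
      unfolding \<epsilon>_def distrib_right[of "e 1 1 N + e 1 2 N"]
      by (intro order_trans[OF norm_vec2_le] add_mono) (simp_all only: S)
  qed
  show "exp_type_remainder x (\<lambda>z. U z *v vector [1, 0])
        (\<lambda>N z. nsbf_init_C z x + 2 *s (\<Sum>n<N. nsbf_term_C K z x n))"
    "exp_type_remainder x (\<lambda>z. U z *v vector [0, 1])
        (\<lambda>N z. nsbf_init_S z x + 2 *s (\<Sum>n<N. nsbf_term_S K z x n))"
    unfolding exp_type_remainder_def using lim pos bC bS by blast+
qed

text \<open>
  The initial value of \<open>\<phi>\<^sub>\<alpha>\<close> is \<open>sin \<alpha>\<close> times that of \<open>C\<close> minus \<open>cos \<alpha>\<close> times that of \<open>S\<close>, and the partial
  sums obey the same linear relation.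
\<close>
lemma nsbf_partial_sum_\<alpha>:
  "nsbf_init_\<alpha> \<alpha> z x + 2 *s (\<Sum>n<N. nsbf_term_\<alpha> \<alpha> K z x n) =
     of_real (sin \<alpha>) *s (nsbf_init_C z x + 2 *s (\<Sum>n<N. nsbf_term_C K z x n))
     + (- of_real (cos \<alpha>)) *s (nsbf_init_S z x + 2 *s (\<Sum>n<N. nsbf_term_S K z x n))"
proof -
  have init: "nsbf_init_\<alpha> \<alpha> z x = of_real (sin \<alpha>) *s nsbf_init_C z x + (- of_real (cos \<alpha>)) *s nsbf_init_S z x"
    by (simp add: vec2_eq_iff nsbf_init_\<alpha>_def nsbf_init_C_def nsbf_init_S_def sin_add cos_add
        sin_of_real cos_of_real)
  have summand: "nsbf_term_\<alpha> \<alpha> K z x n =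
      of_real (sin \<alpha>) *s nsbf_term_C K z x n + (- of_real (cos \<alpha>)) *s nsbf_term_S K z x n" for n
    by (simp add: vec2_eq_iff nsbf_term_\<alpha>_def nsbf_term_C_def nsbf_term_S_def FL_coeff_\<alpha>_def
        FL_coeff_C_def FL_coeff_S_def mat2_vec_component Let_def algebra_simps)
  show ?thesis
    unfolding init summand by (simp add: vec2_eq_iff sum.distrib sum_subtractf sum_distrib_left sum_negf algebra_simps)
qed

theorem theorem3p3:
  fixes p q :: "real \<Rightarrow> real" and \<alpha> :: real
    and U :: "complex \<Rightarrow> real \<Rightarrow> complex^2^2"
    and K :: "real \<Rightarrow> real \<Rightarrow> complex^2^2"
    and C S \<phi> :: "complex \<Rightarrow> real \<Rightarrow> complex^2"
  assumes p: "p square_integrable_on {0..1}" and q: "q square_integrable_on {0..1}"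
    and U: "\<And>z. dirac_matrix_solution p q z (U z)" "\<And>z. U z 0 = mat 1"
    and K: "\<And>x. x \<in> {0..1} \<Longrightarrow> K x square_integrable_on {-x..x}"
    and U_K: "\<And>z x. x \<in> {0..1} \<Longrightarrow>
      U z x = matrix_exp (- (mat (z * of_real x) ** dirac_B))
        + (LINT t|lebesgue_on {-x..x}. K x t ** matrix_exp (- (mat (z * of_real t) ** dirac_B)))"
    and C: "\<And>z. dirac_solution p q z (C z)" "\<And>z. C z 0 = vector [1, 0]"
    and S: "\<And>z. dirac_solution p q z (S z)" "\<And>z. S z 0 = vector [0, 1]"
    and \<phi>: "\<And>z. dirac_solution p q z (\<phi> z)"
      "\<And>z. \<phi> z 0 = vector [of_real (sin \<alpha>), - of_real (cos \<alpha>)]"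
  shows
    "(\<forall>z. \<forall>x\<in>{0..1}.
        summable (nsbf_term_C K z x) \<and>
          C z x = nsbf_init_C z x + 2 *s (\<Sum>n. nsbf_term_C K z x n) \<and>
        summable (nsbf_term_S K z x) \<and>
          S z x = nsbf_init_S z x + 2 *s (\<Sum>n. nsbf_term_S K z x n) \<and>
        summable (nsbf_term_\<alpha> \<alpha> K z x) \<and>
          \<phi> z x = nsbf_init_\<alpha> \<alpha> z x + 2 *s (\<Sum>n. nsbf_term_\<alpha> \<alpha> K z x n)) \<and>
     (\<forall>x\<in>{0..1}. \<forall>A. compact A \<longrightarrow>
        uniform_limit A (\<lambda>N z. nsbf_init_C z x + 2 *s (\<Sum>n<N. nsbf_term_C K z x n))
          (\<lambda>z. C z x) sequentially \<and>
        uniform_limit A (\<lambda>N z. nsbf_init_S z x + 2 *s (\<Sum>n<N. nsbf_term_S K z x n))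
          (\<lambda>z. S z x) sequentially \<and>
        uniform_limit A (\<lambda>N z. nsbf_init_\<alpha> \<alpha> z x + 2 *s (\<Sum>n<N. nsbf_term_\<alpha> \<alpha> K z x n))
          (\<lambda>z. \<phi> z x) sequentially) \<and>
     (\<forall>x\<in>{0..1}.
        Re_independent_remainder_estimate (\<lambda>z. C z x)
          (\<lambda>N z. nsbf_init_C z x + 2 *s (\<Sum>n<N. nsbf_term_C K z x n)) \<and>
        Re_independent_remainder_estimate (\<lambda>z. S z x)
          (\<lambda>N z. nsbf_init_S z x + 2 *s (\<Sum>n<N. nsbf_term_S K z x n)) \<and>
        Re_independent_remainder_estimate (\<lambda>z. \<phi> z x)
          (\<lambda>N z. nsbf_init_\<alpha> \<alpha> z x + 2 *s (\<Sum>n<N. nsbf_term_\<alpha> \<alpha> K z x n)))"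
proof -
  have Y_U: "Y x = U z x *v c"
    if "dirac_solution p q z Y" "Y 0 = c" "x \<in> {0..1}" for Y z x c
    using dirac_solution_unique[OF p q U(1) that(1) _ that(3), of c] that(2) U(2) by simp
  have CU: "C z x = U z x *v vector [1, 0]" and SU: "S z x = U z x *v vector [0, 1]"
    and \<phi>U: "\<phi> z x = of_real (sin \<alpha>) *s C z x + (- of_real (cos \<alpha>)) *s S z x" if x: "x \<in> {0..1}" for z x
    using Y_U[OF C x, of z] Y_U[OF S x, of z] Y_U[OF \<phi> x, of z]
    by (simp_all add: vec2_eq_iff mat2_vec_component algebra_simps)
  have rC: "exp_type_remainder x (\<lambda>z. C z x) (\<lambda>N z. nsbf_init_C z x + 2 *s (\<Sum>n<N. nsbf_term_C K z x n))"
    and rS: "exp_type_remainder x (\<lambda>z. S z x) (\<lambda>N z. nsbf_init_S z x + 2 *s (\<Sum>n<N. nsbf_term_S K z x n))"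
    if x: "x \<in> {0..1}" for x
  proof (atomize (full), cases "x = 0")
    \<comment> \<open>All coefficients are zero at \<open>x = 0\<close> by definition, and the leading terms are the initial values.\<close>
    case True
    have "nsbf_term_C K z 0 n = 0" "nsbf_term_S K z 0 n = 0" for z n
      by (simp_all add: nsbf_term_C_def nsbf_term_S_def FL_coeff_C_def FL_coeff_S_def vec2_eq_iff mat2_vec_component)
    then have "C z 0 - (nsbf_init_C z 0 + 2 *s (\<Sum>n<N. nsbf_term_C K z 0 n)) = 0"
      "S z 0 - (nsbf_init_S z 0 + 2 *s (\<Sum>n<N. nsbf_term_S K z 0 n)) = 0" for z N
      by (simp_all add: C S nsbf_init_C_def nsbf_init_S_def)
    then show "exp_type_remainder x (\<lambda>z. C z x) (\<lambda>N z. nsbf_init_C z x + 2 *s (\<Sum>n<N. nsbf_term_C K z x n)) \<and>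
       exp_type_remainder x (\<lambda>z. S z x) (\<lambda>N z. nsbf_init_S z x + 2 *s (\<Sum>n<N. nsbf_term_S K z x n))"
      unfolding exp_type_remainder_def True by (intro conjI exI[of _ "\<lambda>_. 0"]) auto
  next
    case False
    then have pos: "x > 0" using x by auto
    show "exp_type_remainder x (\<lambda>z. C z x) (\<lambda>N z. nsbf_init_C z x + 2 *s (\<Sum>n<N. nsbf_term_C K z x n)) \<and>
       exp_type_remainder x (\<lambda>z. S z x) (\<lambda>N z. nsbf_init_S z x + 2 *s (\<Sum>n<N. nsbf_term_S K z x n))"
      unfolding CU[OF x] SU[OF x]
      using nsbf_remainder_C[where U = "\<lambda>z. U z x" and K = K, OF pos K[OF x] U_K[OF x]]
        nsbf_remainder_S[where U = "\<lambda>z. U z x" and K = K, OF pos K[OF x] U_K[OF x]] by blast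
  qed
  have r\<phi>: "exp_type_remainder x (\<lambda>z. \<phi> z x) (\<lambda>N z. nsbf_init_\<alpha> \<alpha> z x + 2 *s (\<Sum>n<N. nsbf_term_\<alpha> \<alpha> K z x n))"
    if x: "x \<in> {0..1}" for x
    unfolding nsbf_partial_sum_\<alpha> \<phi>U[OF x] by (intro exp_type_remainder_combine rC rS x)
  have ge0: "x \<ge> 0" if "x \<in> {0..1}" for x :: real using that by simp
  note series = exp_type_remainder_series[OF rC ge0] exp_type_remainder_series[OF rS ge0]
    exp_type_remainder_series[OF r\<phi> ge0]
  note uniform = exp_type_remainder_uniform_limit[OF rC ge0 compact_imp_bounded]
    exp_type_remainder_uniform_limit[OF rS ge0 compact_imp_bounded]
    exp_type_remainder_uniform_limit[OF r\<phi> ge0 compact_imp_bounded]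
  note Re_independent = exp_type_remainder_Re_independent[OF rC ge0]
    exp_type_remainder_Re_independent[OF rS ge0] exp_type_remainder_Re_independent[OF r\<phi> ge0]
  show ?thesis
    by (intro conjI allI ballI impI series uniform Re_independent)
qed

end
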